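(* Let $\mathcal{H}$ be a complex Hilbert space, let $A$ be a bounded linear operator on $\mathcal{H}$, and let $\mathbf{X}=[X_1,\ldots,X_d]$ and $\mathbf{Y}=[Y_1,\ldots,Y_d]$ be two $d$-tuples of commuting bounded algebraic operators on $\mathcal{H}$ (the operators within each tuple commute; $\mathbf{X}$ and $\mathbf{Y}$ need not commute with each other). Let $\mathbf{U}$ (respectively, $\mathbf{V}$) be the semisimple tuple associated with $\mathbf{X}$ (respectively, $\mathbf{Y}$). Then $$\mathrm{Rad}\big(\mathcal{J}(A;\mathbf{X},\mathbf{Y})\big)\subseteq \mathcal{J}(A;\mathbf{U},\mathbf{V}).$$
   Context: Let $\mathbb{C}[\mathbf{x},\mathbf{y}]$ be the ring of complex polynomials in $2d$ commuting variables $\mathbf{x}=(x_1,\ldots,x_d)$, $\mathbf{y}=(y_1,\ldots,y_d)$. For a bounded operator $A$ on $\mathcal{H}$, $d$-tuples of commuting bounded operators $\mathbf{X},\mathbf{Y}$ on $\mathcal{H}$, and $f(\mathbf{x},\mathbf{y})=\sum_{\alpha,\beta}c_{\alpha,\beta}\mathbf{x}^{\alpha}\mathbf{y}^{\beta}$ (finite sum, multiindex notation), define $$f(A;\mathbf{X},\mathbf{Y})=\sum_{\alpha,\beta}c_{\alpha,\beta}(\mathbf{X}^{\alpha})^{*}A\mathbf{Y}^{\beta},\qquad \mathcal{J}(A;\mathbf{X},\mathbf{Y})=\{f\in\mathbb{C}[\mathbf{x},\mathbf{y}]: f(A;\mathbf{X},\mathbf{Y})=0\}.$$ The set $\mathcal{J}(A;\mathbf{X},\mathbf{Y})$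 is an ideal of $\mathbb{C}[\mathbf{x},\mathbf{y}]$. For an ideal $\mathcal{J}$, $\mathrm{Rad}(\mathcal{J})$ is the set of polynomials $p$ with $p^{N}\in\mathcal{J}$ for some positive integer $N$. An operator $T$ is algebraic if $q(T)=0$ for some nonzero complex polynomial $q$ in one variable. Semisimple tuple associated with a tuple: if $\mathbf{T}=[T_1,\ldots,T_d]$ is a tuple of commuting bounded algebraic operators on $\mathcal{H}$, there are a finite set $\Lambda\subset\mathbb{C}^d$ and a direct sum decomposition (not necessarily orthogonal) $\mathcal{H}=\oplus_{\lambda\in\Lambda}\mathcal{H}_{\lambda}$ into closed subspaces such that, for each $\lambda=(\lambda_1,\ldots,\lambda_d)\in\Lambda$ and each $1\leq j\leq d$, $\mathcal{H}_{\lambda}$ is invariant for $T_j$ and $T_j-\lambda_jI$ is nilpotent on $\mathcal{H}_{\lambda}$. (This is the joint generalized eigenspace decomposition, obtained by decomposing successively with respect to $T_1,\ldots,T_d$.) Let $E_{\lambda}$ be the canonical (possibly non-orthogonal) projection of $\mathcal{H}$ onto $\mathcal{H}_{\lambda}$ along the other summands. The semisimple tuple associated with $\mathbf{T}$ is $$\mathbf{S}=\Big[\sum_{\lambda\in\Lambda}\lambda_1E_{\lambda},\ldots,\sum_{\lambda\in\Lambda}\lambda_dE_{\lambda}\Big].$$ It is a tuple of commuting bounded operators. *)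

theory Defs
  imports "HOL-Analysis.Analysis" "HOL-Library.Poly_Mapping"
begin

(* The norm and the real scalar multiplication come from banach; the inner product is linear in
   its first argument. The last axiom says that the norm is the one induced by the inner product,
   and gives positive definiteness. *)
class complex_hilbert_space = banach +
  fixes scaleC :: "complex \<Rightarrow> 'a \<Rightarrow> 'a"
    and cinner :: "'a \<Rightarrow> 'a \<Rightarrow> complex"
  assumes scaleC_add_right: "scaleC c (x + y) = scaleC c x + scaleC c y"
    and scaleC_add_left: "scaleC (b + c) x = scaleC b x + scaleC c x"
    and scaleC_scaleC: "scaleC b (scaleC c x) = scaleC (b * c) x"
    and scaleC_of_real: "scaleC (complex_of_real r) x = scaleR r x"
    and cinner_commute: "cinner x y = cnj (cinner y x)"
    and cinner_add_left: "cinner (x + y) z = cinner x z + cinner y z"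
    and cinner_scaleC_left: "cinner (scaleC c x) y = c * cinner x y"
    and cinner_self: "cinner x x = complex_of_real ((norm x)\<^sup>2)"

instantiation complex :: complex_hilbert_space
begin

definition scaleC_complex :: "complex \<Rightarrow> complex \<Rightarrow> complex"
  where "scaleC_complex c x = c * x"

definition cinner_complex :: "complex \<Rightarrow> complex \<Rightarrow> complex"
  where "cinner_complex x y = x * cnj y"

instance
proof
  fix x :: complex
  show "cinner x x = complex_of_real ((norm x)\<^sup>2)"
    unfolding cinner_complex_def by (simp only: complex_norm_square)
qed (simp_all add: scaleC_complex_def cinner_complex_def scaleR_conv_of_real
    distrib_left distrib_right)

end

interpretation complex_vs:
  vector_space "scaleC :: complex \<Rightarrow> 'h \<Rightarrow> 'h :: complex_hilbert_space"
proof
  fix x :: 'h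
  show "scaleC 1 x = x"
    using scaleC_of_real[of 1 x] by simp
qed (simp_all add: scaleC_add_right scaleC_add_left scaleC_scaleC)

definition bounded_operator :: "('h::complex_hilbert_space \<Rightarrow> 'h) \<Rightarrow> bool"
  where "bounded_operator T \<longleftrightarrow> bounded_linear T \<and> (\<forall>c x. T (scaleC c x) = scaleC c (T x))"

definition hilbert_adjoint :: "('h::complex_hilbert_space \<Rightarrow> 'h) \<Rightarrow> 'h \<Rightarrow> 'h"
  where "hilbert_adjoint T = (THE S. \<forall>x y. cinner (T x) y = cinner x (S y))"

definition algebraic_operator :: "('h::complex_hilbert_space \<Rightarrow> 'h) \<Rightarrow> bool"
  where "algebraic_operator T \<longleftrightarrow>
    (\<exists>q :: complex poly. q \<noteq> 0 \<and>
      (\<forall>x. (\<Sum>i\<le>degree q. scaleC (coeff q i) ((T ^^ i) x)) = 0))"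

(* A d-tuple is a family indexed by a finite type 'd with CARD('d) = d. *)
type_synonym ('d, 'h) op_tuple = "'d \<Rightarrow> 'h \<Rightarrow> 'h"

definition commuting_tuple :: "('d, 'h) op_tuple \<Rightarrow> bool"
  where "commuting_tuple X \<longleftrightarrow> (\<forall>i j. X i \<circ> X j = X j \<circ> X i)"

type_synonym 'd multiindex = "'d \<Rightarrow>\<^sub>0 nat"

(* The ring C[x, y]: the coefficient of x^alpha y^beta is the value at (alpha, beta). Addition of
   multiindices is componentwise, so the multiplication of Poly_Mapping is that of polynomials. *)
type_synonym 'd poly_xy = "('d multiindex \<times> 'd multiindex) \<Rightarrow>\<^sub>0 complex"

(* X^alpha. Finite_Set.fold is meaningful only if the order of the factors does not matter,
   which is the case for commuting tuples; see op_monomial_fold_insert. *)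
definition op_monomial :: "('d::finite, 'h) op_tuple \<Rightarrow> 'd multiindex \<Rightarrow> 'h \<Rightarrow> 'h"
  where "op_monomial X \<alpha> =
    Finite_Set.fold (\<lambda>j P. (X j ^^ Poly_Mapping.lookup \<alpha> j) \<circ> P) id UNIV"

lemma funpow_comp_commute:
  assumes "f \<circ> g = g \<circ> f"
  shows "(f ^^ m) \<circ> (g ^^ n) = (g ^^ n) \<circ> (f ^^ m)"
proof -
  have "f \<circ> (g ^^ n) = (g ^^ n) \<circ> f"
  proof (induction n)
    case (Suc n)
    then show ?case using assms by (simp add: fun_eq_iff)
  qed simp
  then show ?thesis
  proof (induction m)
    case (Suc m)
    then show ?case by (simp add: fun_eq_iff)
  qed simp
qed

lemma op_monomial_fold_insert:
  assumes "commuting_tuple X" and "j \<notin> F" and "finite F"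
  shows "Finite_Set.fold (\<lambda>j P. (X j ^^ Poly_Mapping.lookup \<alpha> j) \<circ> P) id (insert j F) =
    (X j ^^ Poly_Mapping.lookup \<alpha> j) \<circ>
      Finite_Set.fold (\<lambda>j P. (X j ^^ Poly_Mapping.lookup \<alpha> j) \<circ> P) id F"
proof -
  interpret comp_fun_commute "(\<lambda>j P. (X j ^^ Poly_Mapping.lookup \<alpha> j) \<circ> P)"
  proof
    fix i k
    have "(X i ^^ Poly_Mapping.lookup \<alpha> i) \<circ> (X k ^^ Poly_Mapping.lookup \<alpha> k) =
        (X k ^^ Poly_Mapping.lookup \<alpha> k) \<circ> (X i ^^ Poly_Mapping.lookup \<alpha> i)"
      using assms(1) by (intro funpow_comp_commute) (simp add: commuting_tuple_def)
    then show "(\<circ>) (X k ^^ Poly_Mapping.lookup \<alpha> k) \<circ> (\<circ>) (X i ^^ Poly_Mapping.lookup \<alpha> i) =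
        (\<circ>) (X i ^^ Poly_Mapping.lookup \<alpha> i) \<circ> (\<circ>) (X k ^^ Poly_Mapping.lookup \<alpha> k)"
      by (simp add: fun_eq_iff)
  qed
  show ?thesis
    using assms by simp
qed

(* f(A; X, Y), the sum of c_{alpha,beta} (X^alpha)^* A Y^beta. *)
definition op_poly_eval ::
    "'d poly_xy \<Rightarrow> ('h::complex_hilbert_space \<Rightarrow> 'h) \<Rightarrow>
      ('d::finite, 'h) op_tuple \<Rightarrow> ('d, 'h) op_tuple \<Rightarrow> 'h \<Rightarrow> 'h"
  where "op_poly_eval f A X Y = (\<lambda>h. \<Sum>(\<alpha>, \<beta>)\<in>Poly_Mapping.keys f.
    scaleC (Poly_Mapping.lookup f (\<alpha>, \<beta>))
      (hilbert_adjoint (op_monomial X \<alpha>) (A (op_monomial Y \<beta> h))))"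

definition J_ideal ::
    "('h::complex_hilbert_space \<Rightarrow> 'h) \<Rightarrow>
      ('d::finite, 'h) op_tuple \<Rightarrow> ('d, 'h) op_tuple \<Rightarrow> 'd poly_xy set"
  where "J_ideal A X Y = {f. op_poly_eval f A X Y = (\<lambda>h. 0)}"

definition Rad :: "'d poly_xy set \<Rightarrow> 'd poly_xy set"
  where "Rad J = {p. \<exists>N>0. p ^ N \<in> J}"

definition is_direct_sum :: "'i set \<Rightarrow> ('i \<Rightarrow> 'h::complex_hilbert_space set) \<Rightarrow> bool"
  where "is_direct_sum L H \<longleftrightarrow> (\<forall>x. \<exists>!h. h \<in> Pi\<^sub>E L H \<and> x = (\<Sum>l\<in>L. h l))"

definition summand_proj ::
    "'i set \<Rightarrow> ('i \<Rightarrow> 'h::complex_hilbert_space set) \<Rightarrow> 'i \<Rightarrow> 'h \<Rightarrow> 'h"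
  where "summand_proj L H l x = (THE h. h \<in> Pi\<^sub>E L H \<and> x = (\<Sum>m\<in>L. h m)) l"

definition gen_eigenspace_decomposition ::
    "('d, 'h::complex_hilbert_space) op_tuple \<Rightarrow>
      ('d \<Rightarrow> complex) set \<Rightarrow> (('d \<Rightarrow> complex) \<Rightarrow> 'h set) \<Rightarrow> bool"
  where "gen_eigenspace_decomposition T L H \<longleftrightarrow>
    finite L \<and>
    (\<forall>l\<in>L. complex_vs.subspace (H l) \<and> closed (H l)) \<and>
    is_direct_sum L H \<and>
    (\<forall>l\<in>L. \<forall>j. T j ` H l \<subseteq> H l \<and>
      (\<exists>n. \<forall>x\<in>H l. ((\<lambda>y. T j y - scaleC (l j) y) ^^ n) x = 0))"

(* A decomposition exists for commuting bounded algebraic operators, and it is unique up to zero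
   summands, so the choice operator picks the only tuple with this property. *)
definition semisimple_tuple ::
    "('d, 'h::complex_hilbert_space) op_tuple \<Rightarrow> ('d, 'h) op_tuple"
  where "semisimple_tuple T = (SOME S. \<exists>L H. gen_eigenspace_decomposition T L H \<and>
    S = (\<lambda>j x. \<Sum>l\<in>L. scaleC (l j) (summand_proj L H l x)))"

end

theory Submission
  imports Defs "HOL-Computational_Algebra.Fundamental_Theorem_Algebra"
    "HOL-Computational_Algebra.Polynomial_Factorial" "HOL-Computational_Algebra.Field_as_Ring"
begin

text \<open>Restrict the form (h, k) \<mapsto> \<langle>A h, k\<rangle> to the joint generalized eigenspace of Y for m and that of X
  for l. On the restriction, p(A; U, V) acts as the scalar p(cnj l, m), so it suffices that the
  restriction vanishes unless p(cnj l, m) = 0. The operators Y j - m j and X j - l j act on forms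
  through the two arguments; these actions commute and are nilpotent, so applying them to a nonzero
  restriction leads to a nonzero form that they all annihilate. A power of p kills the original
  form, hence also this one, on which it acts as the corresponding power of p(cnj l, m).

  The adjoints require Riesz representation. The projections onto the generalized eigenspaces
  are bounded because they are products of polynomials in the operators.\<close>

subsection \<open>Hilbert spaces and adjoints\<close>

text \<open>The tuples X and Y need not commute with each other, and A need not commute with either.
  Testing f(A; X, Y) h against k moves every monomial in X into the second argument, so X and Y act
  on different arguments of one form, and actions of the two kinds commute automatically. This is
  why the argument is about forms rather than operators. The conjugate of l appears because a form
  is conjugate linear in its second argument.

  The restriction is realized on the whole space as (h, k) \<mapsto> <A (Q h), P k>, with Q and P
  the projections onto the two eigenspaces. They commute with Y and X respectively, so a polynomial
  relation for the original form passes to the restricted one. The radical is absorbed at the end: a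
  complex number with a vanishing power is zero.

  Since \<open>semisimple_tuple\<close> is a choice, nothing can be said about it until a
  decomposition is known to exist. The later argument uses the decomposition behind the chosen
  tuple.\<close>

lemma bounded_operatorD:
  assumes "bounded_operator T"
  shows "bounded_linear T" and "T (x + y) = T x + T y" and "T (x - y) = T x - T y"
    and "T 0 = 0" and "T (scaleC c x) = scaleC c (T x)" and "T (sum g I) = (\<Sum>i\<in>I. T (g i))"
proof -
  show b: "bounded_linear T"
    using assms by (simp add: bounded_operator_def)
  then interpret bounded_linear T .
  show "T (x + y) = T x + T y" "T (x - y) = T x - T y" "T 0 = 0"
      "T (sum g I) = (\<Sum>i\<in>I. T (g i))"
    by (simp_all add: add diff zero sum)
  show "T (scaleC c x) = scaleC c (T x)"
    using assms by (simp add: bounded_operator_def)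
qed

lemma cinner_add_right: "cinner x (y + z) = cinner x y + cinner x z"
  by (metis cinner_add_left cinner_commute complex_cnj_add)

lemma cinner_scaleC_right: "cinner x (scaleC c y) = cnj c * cinner x y"
  by (metis cinner_commute cinner_scaleC_left complex_cnj_mult)

lemma cinner_zero_left [simp]: "cinner 0 x = 0"
  using cinner_add_left[of 0 0 x] by simp

lemma cinner_zero_right [simp]: "cinner x 0 = 0"
  using cinner_add_right[of x 0 0] by simp

lemma cinner_diff_left: "cinner (x - y) z = cinner x z - cinner y z"
  using cinner_add_left[of "x - y" y z] by simp

lemma cinner_diff_right: "cinner x (y - z) = cinner x y - cinner x z"
  using cinner_add_right[of x "y - z" z] by simp

lemma cinner_sum_left: "cinner (sum g I) x = (\<Sum>i\<in>I. cinner (g i) x)"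
  by (induction I rule: infinite_finite_induct) (simp_all add: cinner_add_left)

lemma cinner_sum_right: "cinner x (sum g I) = (\<Sum>i\<in>I. cinner x (g i))"
  by (induction I rule: infinite_finite_induct) (simp_all add: cinner_add_right)

lemma cinner_self_eq_0_iff: "cinner x x = 0 \<longleftrightarrow> x = 0"
  by (simp add: cinner_self)

lemma cinner_ext:
  assumes "\<And>x. cinner x y = cinner x z"
  shows "y = z"
  using assms[of "y - z"] cinner_self_eq_0_iff[of "y - z"] by (simp add: cinner_diff_right)

lemma norm_scaleC: "norm (scaleC c x) = cmod c * norm (x :: 'h :: complex_hilbert_space)"
proof -
  have "complex_of_real ((norm (scaleC c x))\<^sup>2) = complex_of_real ((cmod c * norm x)\<^sup>2)"
    unfolding power_mult_distrib of_real_mult complex_norm_square cinner_self[symmetric]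
    by (simp add: cinner_scaleC_left cinner_scaleC_right)
  then have "(norm (scaleC c x))\<^sup>2 = (cmod c * norm x)\<^sup>2"
    by (simp only: of_real_eq_iff)
  then show ?thesis
    by (simp add: power2_eq_iff_nonneg)
qed

lemma norm_diff_scaleC_square:
  "complex_of_real ((norm (x - scaleC c y))\<^sup>2) =
    (norm x)\<^sup>2 - cnj c * cinner x y - c * cnj (cinner x y) + c * cnj c * (norm y)\<^sup>2"
  unfolding cinner_self[symmetric] using cinner_commute[of y x]
  by (simp add: cinner_diff_left cinner_diff_right cinner_scaleC_left
      cinner_scaleC_right algebra_simps)

text \<open>The coefficient is that of the orthogonal projection of x onto the line through y. The
  resulting loss in norm forces both the Cauchy-Schwarz inequality and the orthogonality in the
  Riesz theorem.\<close>

lemma norm_diff_projection_square: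
  assumes "y \<noteq> 0"
  shows "(norm (x - scaleC (cinner x y / (norm y)\<^sup>2) y))\<^sup>2 =
    (norm x)\<^sup>2 - (cmod (cinner x y))\<^sup>2 / (norm y)\<^sup>2"
proof -
  have "complex_of_real ((norm (x - scaleC (cinner x y / (norm y)\<^sup>2) y))\<^sup>2) =
      (norm x)\<^sup>2 - cinner x y * cnj (cinner x y) / (norm y)\<^sup>2"
    unfolding norm_diff_scaleC_square using assms
    by (simp add: field_simps power2_eq_square)
  also have "\<dots> = complex_of_real ((norm x)\<^sup>2 - (cmod (cinner x y))\<^sup>2 / (norm y)\<^sup>2)"
    unfolding of_real_diff of_real_divide complex_norm_square[symmetric] by simp
  finally show ?thesis
    by (simp only: of_real_eq_iff)
qed

lemma cinner_Cauchy_Schwarz: "cmod (cinner x y) \<le> norm x * norm y"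
proof (cases "y = 0")
  case False
  then have "(cmod (cinner x y))\<^sup>2 / (norm y)\<^sup>2 \<le> (norm x)\<^sup>2"
    using norm_diff_projection_square[of y x] zero_le_power2[of "norm (x - scaleC (cinner x y / (norm y)\<^sup>2) y)"]
    by linarith
  then have "(cmod (cinner x y))\<^sup>2 \<le> (norm x * norm y)\<^sup>2"
    using False by (simp add: field_simps power_mult_distrib)
  then show ?thesis
    by (rule power2_le_imp_le) simp
qed simp

lemma parallelogram_law:
  fixes x y :: "'h :: complex_hilbert_space"
  shows "(norm (x + y))\<^sup>2 + (norm (x - y))\<^sup>2 = 2 * (norm x)\<^sup>2 + 2 * (norm y)\<^sup>2"
proof -
  have "complex_of_real ((norm (x + y))\<^sup>2 + (norm (x - y))\<^sup>2) =
      complex_of_real (2 * (norm x)\<^sup>2 + 2 * (norm y)\<^sup>2)"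
    unfolding of_real_add of_real_mult cinner_self[symmetric]
    by (simp add: cinner_add_left cinner_add_right cinner_diff_left cinner_diff_right)
  then show ?thesis
    by (simp only: of_real_eq_iff)
qed

text \<open>By the parallelogram law, two points of nearly minimal norm are close to each other,
  because their midpoint is no shorter than the infimum. A minimizing sequence is therefore
  Cauchy.\<close>

lemma closed_midpoint_convex_has_min_norm:
  fixes C :: "'h :: complex_hilbert_space set"
  assumes "closed C" and "C \<noteq> {}"
    and mid: "\<And>x y. x \<in> C \<Longrightarrow> y \<in> C \<Longrightarrow> scaleR (1/2) (x + y) \<in> C"
  obtains z where "z \<in> C" and "\<And>x. x \<in> C \<Longrightarrow> norm z \<le> norm x"
proof -
  define d where "d = (INF x\<in>C. norm x)"
  have bdd: "bdd_below (norm ` C)"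
    by (rule bdd_belowI[of _ 0]) auto
  have d_le: "d \<le> norm x" if "x \<in> C" for x
    unfolding d_def using bdd that by (rule cINF_lower)
  have d_nonneg: "d \<ge> 0"
    unfolding d_def using assms(2) by (intro cINF_greatest) auto
  have "\<exists>x\<in>C. norm x < d + inverse (Suc n)" for n
    using cINF_less_iff[OF assms(2) bdd, of "d + inverse (Suc n)"] by (simp add: d_def)
  then obtain s where s: "\<And>n. s n \<in> C" "\<And>n. norm (s n) < d + inverse (Suc n)"
    by metis
  have lim: "(\<lambda>n. norm (s n)) \<longlonglongrightarrow> d"
  proof (rule tendsto_sandwich)
    show "\<forall>\<^sub>F n in sequentially. d \<le> norm (s n)"
      using d_le s by simp
    show "\<forall>\<^sub>F n in sequentially. norm (s n) \<le> d + inverse (Suc n)"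
      using s(2) by (intro always_eventually allI less_imp_le)
    show "(\<lambda>n. d + inverse (real (Suc n))) \<longlonglongrightarrow> d"
      by (rule LIMSEQ_inverse_real_of_nat_add)
  qed simp
  have para: "(norm (x - y))\<^sup>2 \<le> 2 * ((norm x)\<^sup>2 - d\<^sup>2) + 2 * ((norm y)\<^sup>2 - d\<^sup>2)"
    if "x \<in> C" "y \<in> C" for x y
  proof -
    have "d \<le> norm (x + y) / 2"
      using d_le[OF mid[OF that]] by simp
    then have "(2 * d)\<^sup>2 \<le> (norm (x + y))\<^sup>2"
      using d_nonneg by (intro power_mono) auto
    with parallelogram_law[of x y] show ?thesis
      by (simp add: power_mult_distrib)
  qed
  have "Cauchy s"
  proof (rule CauchyI)
    fix e :: real assume "e > 0"
    have "(\<lambda>n. (norm (s n))\<^sup>2) \<longlonglongrightarrow> d\<^sup>2"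
      using lim by (intro tendsto_intros)
    \<comment> \<open>The slack e^2/4 enters \<open>para\<close> twice, each time with the factor 2,
      which adds up to e^2.\<close>
    then have "\<forall>\<^sub>F n in sequentially. (norm (s n))\<^sup>2 < d\<^sup>2 + e\<^sup>2 / 4"
      using \<open>e > 0\<close> by (intro order_tendstoD) auto
    then obtain M where M: "\<And>n. n \<ge> M \<Longrightarrow> (norm (s n))\<^sup>2 < d\<^sup>2 + e\<^sup>2 / 4"
      by (auto simp: eventually_sequentially)
    have "norm (s m - s n) < e" if "m \<ge> M" "n \<ge> M" for m n
    proof (rule power2_less_imp_less)
      have "(norm (s m))\<^sup>2 - d\<^sup>2 < e\<^sup>2 / 4" "(norm (s n))\<^sup>2 - d\<^sup>2 < e\<^sup>2 / 4"
        using M[OF that(1)] M[OF that(2)] by (simp_all only: diff_less_eq add.commute)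
      then show "(norm (s m - s n))\<^sup>2 < e\<^sup>2"
        using para[OF s(1) s(1), of m n] by argo
    qed (use \<open>e > 0\<close> in simp)
    then show "\<exists>M. \<forall>m\<ge>M. \<forall>n\<ge>M. norm (s m - s n) < e"
      by blast
  qed
  then obtain z where z: "s \<longlonglongrightarrow> z"
    by (auto simp: Cauchy_convergent_iff convergent_def)
  show ?thesis
  proof
    show "z \<in> C"
      using closed_sequentially[OF assms(1)] s(1) z by blast
    have "norm z = d"
      using tendsto_norm[OF z] lim by (rule LIMSEQ_unique)
    then show "norm z \<le> norm x" if "x \<in> C" for x
      using d_le that by simp
  qed
qed

text \<open>The shortest vector z of the affine hyperplane where \<phi> is 1 is orthogonal to the
  kernel of \<phi>: otherwise removing its component along a kernel vector would give a shorter
  vector of the hyperplane.\<close>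

lemma Riesz_representation:
  fixes \<phi> :: "'h :: complex_hilbert_space \<Rightarrow> complex"
  assumes "bounded_linear \<phi>" and "\<And>c x. \<phi> (scaleC c x) = c * \<phi> x"
  shows "\<exists>y. \<forall>x. \<phi> x = cinner x y"
proof (cases "\<forall>x. \<phi> x = 0")
  case True
  then show ?thesis
    by (intro exI[of _ 0]) simp
next
  case False
  interpret bounded_linear \<phi> by fact
  define C where "C = {x. \<phi> x = 1}"
  obtain x0 where "\<phi> x0 \<noteq> 0"
    using False by blast
  then have "scaleC (1 / \<phi> x0) x0 \<in> C"
    by (simp add: C_def assms(2))
  moreover have "closed C"
    unfolding C_def
    by (intro closed_Collect_eq continuous_intros linear_continuous_on assms(1))
  moreover have "scaleR (1/2) (x + y) \<in> C" if "x \<in> C" "y \<in> C" for x y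
    using that by (simp add: C_def add scaleR scaleR_conv_of_real)
  ultimately obtain z where z: "z \<in> C" "\<And>x. x \<in> C \<Longrightarrow> norm z \<le> norm x"
    using closed_midpoint_convex_has_min_norm[of C] by blast
  have "z \<noteq> 0"
    using z(1) zero by (auto simp: C_def)
  have orth: "cinner w z = 0" if "\<phi> w = 0" for w
  proof (cases "w = 0")
    case False
    have "z - scaleC (cinner z w / (norm w)\<^sup>2) w \<in> C"
      using z(1) that by (simp add: C_def diff assms(2))
    then have "(norm z)\<^sup>2 \<le> (norm (z - scaleC (cinner z w / (norm w)\<^sup>2) w))\<^sup>2"
      by (intro power_mono z(2)) auto
    then have "(cmod (cinner z w))\<^sup>2 / (norm w)\<^sup>2 \<le> 0"
      by (simp only: norm_diff_projection_square[OF False])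
    then have "cinner z w = 0"
      using False by (simp add: divide_le_0_iff)
    then show ?thesis
      using cinner_commute[of w z] by simp
  qed simp
  \<comment> \<open>Since x - \<phi>(x) z lies in the kernel, <x, z> is \<phi>(x) times the squared
    norm of z. This fixes the scaling of the representing vector.\<close>
  have "\<phi> x = cinner x (scaleC (1 / (norm z)\<^sup>2) z)" for x
  proof -
    have "cinner (x - scaleC (\<phi> x) z) z = 0"
      using z(1) by (intro orth) (simp add: C_def diff assms(2))
    then show ?thesis
      using \<open>z \<noteq> 0\<close>
      by (simp add: cinner_diff_left cinner_scaleC_left cinner_scaleC_right cinner_self)
  qed
  then show ?thesis by blast
qed

text \<open>\<open>hilbert_adjoint\<close> is a definite description: Riesz supplies a value for
  each y, and \<open>cinner_ext\<close> shows that there is no other.\<close>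

lemma cinner_hilbert_adjoint:
  assumes "bounded_operator T"
  shows "cinner x (hilbert_adjoint T y) = cinner (T x) y"
proof -
  note T = bounded_operatorD[OF assms]
  interpret T: bounded_linear T by (rule T)
  have "\<exists>z. \<forall>x. cinner (T x) y = cinner x z" for y
  proof (rule Riesz_representation)
    obtain K where K: "\<And>x. norm (T x) \<le> norm x * K"
      using T.bounded by blast
    show "bounded_linear (\<lambda>x. cinner (T x) y)"
    proof (rule bounded_linear_intro)
      show "cmod (cinner (T x) y) \<le> norm x * (K * norm y)" for x
        using cinner_Cauchy_Schwarz[of "T x" y] mult_right_mono[OF K[of x] norm_ge_zero[of y]]
        by (simp add: mult.assoc)
    qed (simp_all add: T cinner_add_left cinner_scaleC_left scaleR_conv_of_real
        flip: scaleC_of_real)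
  qed (simp add: T cinner_scaleC_left)
  then obtain S where S: "\<forall>x y. cinner (T x) y = cinner x (S y)"
    by metis
  have "hilbert_adjoint T = S"
    unfolding hilbert_adjoint_def
  proof (rule the_equality[where P = "\<lambda>S. \<forall>x y. cinner (T x) y = cinner x (S y)", OF S])
    fix S' assume "\<forall>x y. cinner (T x) y = cinner x (S' y)"
    with S show "S' = S"
      by (metis cinner_ext ext)
  qed
  with S show ?thesis by simp
qed

section \<open>Closure properties of bounded operators\<close>

lemma bounded_operator_id: "bounded_operator (\<lambda>x. x)"
  by (simp add: bounded_operator_def)

lemma bounded_operator_zero: "bounded_operator (\<lambda>x. 0)"
  by (simp add: bounded_operator_def)

lemma bounded_operator_compose:
  assumes "bounded_operator S" and "bounded_operator T"
  shows "bounded_operator (\<lambda>x. S (T x))"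
  using assms by (simp add: bounded_operator_def bounded_linear_compose)

lemma bounded_operator_add:
  assumes "bounded_operator S" and "bounded_operator T"
  shows "bounded_operator (\<lambda>x. S x + T x)"
  using assms by (simp add: bounded_operator_def bounded_linear_add scaleC_add_right)

lemma bounded_operator_scaleC:
  assumes "bounded_operator T"
  shows "bounded_operator (\<lambda>x. scaleC c (T x))"
proof -
  note T = bounded_operatorD[OF assms]
  interpret T: bounded_linear T by (rule T)
  obtain K where K: "\<And>x. norm (T x) \<le> norm x * K"
    using T.bounded by blast
  have "bounded_linear (\<lambda>x. scaleC c (T x))"
  proof (rule bounded_linear_intro)
    show "norm (scaleC c (T x)) \<le> norm x * (K * cmod c)" for x
      using mult_right_mono[OF K[of x] norm_ge_zero[of c]] by (simp add: norm_scaleC ac_simps)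
  qed (simp_all add: T.add scaleC_add_right scaleC_scaleC mult.commute T
      flip: scaleC_of_real)
  then show ?thesis
    by (simp add: bounded_operator_def T scaleC_scaleC mult.commute)
qed

lemma bounded_operator_sum:
  assumes "\<And>i. i \<in> I \<Longrightarrow> bounded_operator (T i)"
  shows "bounded_operator (\<lambda>x. \<Sum>i\<in>I. T i x)"
  using assms
  by (induction I rule: infinite_finite_induct)
    (simp_all add: bounded_operator_zero bounded_operator_add)

lemma bounded_operator_diff_scaleC:
  assumes "bounded_operator T"
  shows "bounded_operator (\<lambda>x. T x - scaleC c x)"
  using bounded_operator_add[OF assms bounded_operator_scaleC[OF bounded_operator_id, of "- c"]]
  by simp

subsection \<open>Polynomials in one operator\<close>

text \<open>The body is literally the sum in \<open>algebraic_operator_def\<close>, so that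
  unfolding turns algebraicity into a statement about \<open>op_poly\<close>.\<close>

definition op_poly :: "complex poly \<Rightarrow> ('h::complex_hilbert_space \<Rightarrow> 'h) \<Rightarrow> 'h \<Rightarrow> 'h"
  where "op_poly q T x = (\<Sum>i\<le>degree q. scaleC (coeff q i) ((T ^^ i) x))"

lemma op_poly_0 [simp]: "op_poly 0 T x = 0"
  by (simp add: op_poly_def)

text \<open>Horner's recursion, from which the calculus below follows by induction over
  \<open>pCons\<close>. The zero polynomial is treated separately because the degree does not grow
  there.\<close>

lemma op_poly_pCons:
  assumes "bounded_operator T"
  shows "op_poly (pCons a q) T x = scaleC a x + T (op_poly q T x)"
proof (cases "q = 0")
  case True
  then show ?thesis
    using bounded_operatorD(4)[OF assms] by (simp add: op_poly_def)
next
  case False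
  then have "op_poly (pCons a q) T x =
      scaleC a x + (\<Sum>i\<le>degree q. scaleC (coeff q i) (T ((T ^^ i) x)))"
    by (simp add: op_poly_def degree_pCons_eq sum.atMost_Suc_shift del: sum.atMost_Suc)
  then show ?thesis
    by (simp add: op_poly_def bounded_operatorD[OF assms])
qed

lemma op_poly_1 [simp]: "op_poly 1 T x = x"
  by (simp add: op_poly_def)

lemma op_poly_linear:
  assumes "bounded_operator T"
  shows "op_poly [:- a, 1:] T x = T x - scaleC a x"
  using bounded_operatorD(4)[OF assms] by (simp add: op_poly_pCons[OF assms])

lemma op_poly_smult:
  assumes "bounded_operator T"
  shows "op_poly (smult c q) T x = scaleC c (op_poly q T x)"
  by (induction q) (simp_all add: op_poly_pCons[OF assms] bounded_operatorD[OF assms]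
      scaleC_add_right scaleC_scaleC)

lemma op_poly_add:
  assumes "bounded_operator T"
  shows "op_poly (p + q) T x = op_poly p T x + op_poly q T x"
proof (induction p q rule: poly_induct2)
  case (pCons a p b q)
  then show ?case
    by (simp add: op_poly_pCons[OF assms] bounded_operatorD[OF assms] scaleC_add_left)
qed simp

lemma op_poly_diff:
  assumes "bounded_operator T"
  shows "op_poly (p - q) T x = op_poly p T x - op_poly q T x"
  using op_poly_add[OF assms, of "p - q" q x] by simp

lemma op_poly_sum:
  assumes "bounded_operator T"
  shows "op_poly (sum g I) T x = (\<Sum>i\<in>I. op_poly (g i) T x)"
  by (induction I rule: infinite_finite_induct) (simp_all add: op_poly_add[OF assms])

lemma op_poly_mult:
  assumes "bounded_operator T"
  shows "op_poly (p * q) T x = op_poly p T (op_poly q T x)"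
  by (induction p) (simp_all add: op_poly_pCons[OF assms] op_poly_add[OF assms]
      op_poly_smult[OF assms] bounded_operatorD[OF assms])

lemma bounded_operator_op_poly:
  assumes "bounded_operator T"
  shows "bounded_operator (op_poly q T)"
proof (induction q)
  case 0
  have "op_poly 0 T = (\<lambda>x. 0)"
    by auto
  then show ?case
    by (simp add: bounded_operator_zero)
next
  case (pCons a q)
  have "op_poly (pCons a q) T = (\<lambda>x. scaleC a x + T (op_poly q T x))"
    by (simp add: fun_eq_iff op_poly_pCons[OF assms])
  then show ?case
    using pCons.IH assms
    by (simp add: bounded_operator_add bounded_operator_scaleC bounded_operator_id
        bounded_operator_compose)
qed

lemma op_poly_commute:
  assumes "bounded_operator T" and "bounded_operator S" and "\<And>x. S (T x) = T (S x)"
  shows "S (op_poly q T x) = op_poly q T (S x)"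
  by (induction q) (simp_all add: op_poly_pCons[OF assms(1)] bounded_operatorD[OF assms(2)] assms(3))

lemma op_poly_linear_power:
  assumes "bounded_operator T"
  shows "op_poly ([:- a, 1:] ^ n) T x = ((\<lambda>y. T y - scaleC a y) ^^ n) x"
  by (induction n) (simp_all add: op_poly_mult[OF assms] op_poly_linear[OF assms] del: mult_pCons_left)

lemma op_poly_mem_subspace:
  assumes "bounded_operator T" and "complex_vs.subspace V" and "T ` V \<subseteq> V" and "x \<in> V"
  shows "op_poly q T x \<in> V"
  by (induction q) (use assms in \<open>auto simp: op_poly_pCons complex_vs.subspace_0
      intro!: complex_vs.subspace_add complex_vs.subspace_scale\<close>)

lemma op_poly_dvd:
  assumes "bounded_operator T" and "p dvd q" and "op_poly p T x = 0"
  shows "op_poly q T x = 0"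
proof -
  obtain r where "q = r * p"
    using assms(2) by (metis dvdE mult.commute)
  then show ?thesis
    using bounded_operatorD(4)[OF bounded_operator_op_poly[OF assms(1)]] assms
    by (simp add: op_poly_mult)
qed

section \<open>Coprime powers of linear factors and partial fractions\<close>

lemma coprime_linear_powers:
  fixes a b :: complex
  assumes "a \<noteq> b"
  shows "coprime ([:- a, 1:] ^ m) ([:- b, 1:] ^ n)"
proof -
  have "coprime [:- a, 1:] [:- b, 1:]"
  proof (rule coprimeI)
    fix c assume "c dvd [:- a, 1:]" "c dvd [:- b, 1:]"
    then have "c dvd [:- a, 1:] - [:- b, 1:]"
      by (rule dvd_diff)
    moreover have "is_unit ([:- a, 1:] - [:- b, 1:])"
      using assms by (simp add: is_unit_pCons_iff)
    ultimately show "is_unit c"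
      by (rule dvd_trans)
  qed
  then show ?thesis by simp
qed

lemma coprime_bezout:
  fixes p q :: "complex poly"
  assumes "coprime p q"
  obtains s t where "s * p + t * q = 1"
  using bezout_coefficients_fst_snd[of p q] assms by (metis coprime_iff_gcd_eq_1)

text \<open>The Chinese remainder theorem for two moduli. Evaluated at an operator, q is the
  identity on vectors killed by the power for a, and zero on vectors killed by the power for
  b.\<close>

lemma separating_poly:
  fixes a b :: complex
  assumes "a \<noteq> b"
  shows "\<exists>q. [:- a, 1:] ^ m dvd q - 1 \<and> [:- b, 1:] ^ n dvd q"
proof -
  obtain s t where "s * [:- a, 1:] ^ m + t * [:- b, 1:] ^ n = 1"
    using coprime_linear_powers[OF assms] by (rule coprime_bezout)
  then have "t * [:- b, 1:] ^ n - 1 = - s * [:- a, 1:] ^ m"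
    by (simp add: algebra_simps)
  then show ?thesis
    by (intro exI[of _ "t * [:- b, 1:] ^ n"]) simp
qed

text \<open>The e r are the components of 1 in the splitting of C[x] modulo Q into primary parts.
  Divisibility replaces the quotient ring so that they can be evaluated at an operator annihilated
  by Q.\<close>

lemma partial_fractions:
  fixes n :: "complex \<Rightarrow> nat"
  assumes "finite R"
  defines "Q \<equiv> (\<Prod>r\<in>R. [:- r, 1:] ^ n r)"
  shows "\<exists>e. Q dvd (\<Sum>r\<in>R. e r) - 1 \<and> (\<forall>r\<in>R. Q dvd [:- r, 1:] ^ n r * e r)"
  using assms(1) unfolding Q_def
proof (induction R)
  case (insert a R)
  define Q where "Q = (\<Prod>r\<in>R. [:- r, 1:] ^ n r)"
  define l where "l = [:- a, 1:] ^ n a"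
  obtain e where e: "Q dvd (\<Sum>r\<in>R. e r) - 1" "\<And>r. r \<in> R \<Longrightarrow> Q dvd [:- r, 1:] ^ n r * e r"
    using insert.IH by (auto simp: Q_def)
  have "coprime Q l"
    unfolding Q_def l_def using insert.hyps
    by (intro prod_coprime_left coprime_linear_powers) auto
  then obtain s t where st: "s * Q + t * l = 1"
    by (rule coprime_bezout)
  \<comment> \<open>The Bezout identity splits 1 into s Q, which \<open>l\<close> sends to a
    multiple of l Q and which therefore serves the new root, and t l, which multiplies the old
    components.\<close>
  define e' where "e' = (\<lambda>r. if r = a then s * Q else t * l * e r)"
  have "(\<Sum>r\<in>R. e' r) = t * l * (\<Sum>r\<in>R. e r)"
    unfolding sum_distrib_left using insert.hyps by (intro sum.cong) (auto simp: e'_def)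
  then have "(\<Sum>r\<in>insert a R. e' r) - 1 = s * Q + t * l * (\<Sum>r\<in>R. e r) - (s * Q + t * l)"
    using insert.hyps st by (simp add: e'_def)
  also have "\<dots> = t * (l * ((\<Sum>r\<in>R. e r) - 1))"
    by (simp add: algebra_simps)
  finally have "l * Q dvd (\<Sum>r\<in>insert a R. e' r) - 1"
    using e(1) by (metis dvd_mult dvd_refl mult_dvd_mono)
  moreover have "l * Q dvd [:- r, 1:] ^ n r * e' r" if "r \<in> insert a R" for r
  proof (cases "r = a")
    case True
    then have "[:- r, 1:] ^ n r * e' r = s * (l * Q)"
      by (simp add: e'_def l_def)
    then show ?thesis
      by simp
  next
    case False
    then have "[:- r, 1:] ^ n r * e' r = t * (l * ([:- r, 1:] ^ n r * e r))"
      by (simp add: e'_def)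
    then show ?thesis
      using e(2)[of r] that False by (metis dvd_mult dvd_refl insertE mult_dvd_mono)
  qed
  moreover have "(\<Prod>r\<in>insert a R. [:- r, 1:] ^ n r) = l * Q"
    using insert.hyps by (simp add: l_def Q_def)
  ultimately show ?case by metis
qed simp

text \<open>An annihilating polynomial splits over the complex numbers. Evaluating the partial
  fractions of its roots with multiplicities at T writes every vector as a sum of generalized
  eigenvectors.\<close>

lemma algebraic_operator_partial_fractions:
  assumes "bounded_operator T" and "algebraic_operator T"
  shows "\<exists>R n e. finite R \<and> (\<forall>x. x = (\<Sum>r\<in>R. op_poly (e r) T x)) \<and>
    (\<forall>r\<in>R. \<forall>x. op_poly ([:- r, 1:] ^ n r) T (op_poly (e r) T x) = 0)"
proof -
  obtain q where q: "q \<noteq> 0" "\<And>x. op_poly q T x = 0"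
    using assms(2) unfolding algebraic_operator_def op_poly_def by blast
  define R where "R = {r. poly q r = 0}"
  define n where "n = (\<lambda>r. order r q)"
  define Q where "Q = (\<Prod>r\<in>R. [:- r, 1:] ^ n r)"
  have R: "finite R"
    unfolding R_def using q(1) by (rule poly_roots_finite)
  have "smult (lead_coeff q) Q = q"
    unfolding Q_def R_def n_def by (rule complex_poly_decompose)
  then have "q dvd Q"
    using q(1) by (metis dvd_refl leading_coeff_neq_0 smult_dvd_iff)
  then have Q: "op_poly p T x = 0" if "Q dvd p" for p x
    using op_poly_dvd[OF assms(1) dvd_trans[OF _ that] q(2)] by blast
  obtain e where e: "Q dvd (\<Sum>r\<in>R. e r) - 1" "\<And>r. r \<in> R \<Longrightarrow> Q dvd [:- r, 1:] ^ n r * e r"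
    using partial_fractions[OF R, of n] by (auto simp: Q_def)
  have "x = (\<Sum>r\<in>R. op_poly (e r) T x)" for x
    using Q[OF e(1), of x] by (simp add: op_poly_diff[OF assms(1)] op_poly_sum[OF assms(1)])
  moreover have "op_poly ([:- r, 1:] ^ n r) T (op_poly (e r) T x) = 0" if "r \<in> R" for r x
    using Q[OF e(2)[OF that], of x] by (simp add: op_poly_mult[OF assms(1)])
  ultimately show ?thesis
    using R by blast
qed

subsection \<open>Joint generalized eigenspaces\<close>

text \<open>These conditions alone make components unique
  (\<open>gen_eigenspace_sum_inject\<close>). The existence proof appeals to this before
  \<open>is_direct_sum\<close> is established.\<close>

definition gen_eigenspace_family ::
    "('d, 'h::complex_hilbert_space) op_tuple \<Rightarrow>
      ('d \<Rightarrow> complex) set \<Rightarrow> (('d \<Rightarrow> complex) \<Rightarrow> 'h set) \<Rightarrow> bool"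
  where "gen_eigenspace_family T L H \<longleftrightarrow>
    finite L \<and>
    (\<forall>l\<in>L. complex_vs.subspace (H l)) \<and>
    (\<forall>l\<in>L. \<forall>j. T j ` H l \<subseteq> H l \<and>
      (\<exists>n. \<forall>x\<in>H l. ((\<lambda>y. T j y - scaleC (l j) y) ^^ n) x = 0))"

lemma gen_eigenspace_decomposition_family:
  "gen_eigenspace_decomposition T L H \<Longrightarrow> gen_eigenspace_family T L H"
  unfolding gen_eigenspace_decomposition_def gen_eigenspace_family_def by blast

text \<open>Two different joint eigenvalues differ in some coordinate, and there a polynomial in the
  corresponding operator separates the two summands.\<close>
lemma gen_eigenspace_separating_operator:
  assumes T: "\<And>j. bounded_operator (T j)" and fam: "gen_eigenspace_family T L H"
    and "l \<in> L" and "F \<subseteq> L - {l}"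
  shows "\<exists>E. bounded_operator E \<and> (\<forall>m\<in>L. \<forall>x\<in>H m. E x \<in> H m) \<and>
    (\<forall>x\<in>H l. E x = x) \<and> (\<forall>m\<in>F. \<forall>x\<in>H m. E x = 0)"
proof -
  have "finite (L - {l})"
    using fam by (simp add: gen_eigenspace_family_def)
  with assms(4) have "finite F"
    by (rule finite_subset)
  then show ?thesis
    using assms(4)
  proof (induction F)
    case empty
    then show ?case
      by (intro exI[of _ "\<lambda>x. x"]) (simp add: bounded_operator_id)
  next
    case (insert m F)
    then have "F \<subseteq> L - {l}"
      by simp
    from insert.IH[OF this] obtain E where E: "bounded_operator E"
      "\<forall>k\<in>L. \<forall>x\<in>H k. E x \<in> H k" "\<forall>x\<in>H l. E x = x" "\<forall>k\<in>F. \<forall>x\<in>H k. E x = 0"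
      by (elim exE conjE)
    have m: "m \<in> L" "m \<noteq> l"
      using insert.prems by auto
    then obtain j where j: "l j \<noteq> m j"
      by (metis ext)
    obtain n where n: "\<And>x. x \<in> H l \<Longrightarrow> ((\<lambda>y. T j y - scaleC (l j) y) ^^ n) x = 0"
      using fam \<open>l \<in> L\<close> unfolding gen_eigenspace_family_def by blast
    obtain n' where n': "\<And>x. x \<in> H m \<Longrightarrow> ((\<lambda>y. T j y - scaleC (m j) y) ^^ n') x = 0"
      using fam m unfolding gen_eigenspace_family_def by blast
    obtain q where q: "[:- l j, 1:] ^ n dvd q - 1" "[:- m j, 1:] ^ n' dvd q"
      using separating_poly[OF j] by blast
    have q_l: "op_poly q (T j) x = x" if "x \<in> H l" for x
      using op_poly_dvd[OF T q(1)] n[OF that]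
      by (simp add: op_poly_linear_power[OF T] op_poly_diff[OF T])
    have q_m: "op_poly q (T j) x = 0" if "x \<in> H m" for x
      using op_poly_dvd[OF T q(2)] n'[OF that] by (simp add: op_poly_linear_power[OF T])
    have q_inv: "op_poly q (T j) x \<in> H k" if "k \<in> L" "x \<in> H k" for k x
    proof (rule op_poly_mem_subspace[OF T _ _ that(2)])
      show "complex_vs.subspace (H k)" "T j ` H k \<subseteq> H k"
        using fam that(1) unfolding gen_eigenspace_family_def by blast+
    qed
    show ?case
    proof (intro exI[of _ "\<lambda>x. op_poly q (T j) (E x)"] conjI ballI)
      show "bounded_operator (\<lambda>x. op_poly q (T j) (E x))"
        by (rule bounded_operator_compose[OF bounded_operator_op_poly[OF T] E(1)])
      fix x
      show "op_poly q (T j) (E x) \<in> H k" if "k \<in> L" "x \<in> H k" for k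
        using E(2) that by (intro q_inv) blast+
      show "op_poly q (T j) (E x) = x" if "x \<in> H l"
        using E(3) that q_l[OF that] by simp
      show "op_poly q (T j) (E x) = 0" if k: "k \<in> insert m F" "x \<in> H k" for k
      proof (cases "k = m")
        case True
        then show ?thesis
          using E(2) m(1) k(2) by (intro q_m) blast
      next
        case False
        then have "E x = 0"
          using E(4) k by blast
        then show ?thesis
          by (simp only: bounded_operatorD(4)[OF bounded_operator_op_poly[OF T]])
      qed
    qed
  qed
qed

text \<open>The operator separating l from all other indices removes every term of the sum but one.
  It yields the uniqueness of components and, being bounded, the boundedness of the
  projections.\<close>

lemma gen_eigenspace_projection:
  assumes "\<And>j. bounded_operator (T j)" and "gen_eigenspace_family T L H" and "l \<in> L"
  obtains E where "bounded_operator E"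
    and "\<And>h. h \<in> Pi L H \<Longrightarrow> E (\<Sum>m\<in>L. h m) = h l"
proof -
  obtain E where E: "bounded_operator E" "\<And>x. x \<in> H l \<Longrightarrow> E x = x"
    "\<And>m x. m \<in> L \<Longrightarrow> m \<noteq> l \<Longrightarrow> x \<in> H m \<Longrightarrow> E x = 0"
    using gen_eigenspace_separating_operator[OF assms subset_refl] by blast
  have "E (\<Sum>m\<in>L. h m) = h l" if "h \<in> Pi L H" for h
  proof -
    have "finite L"
      using assms(2) by (simp add: gen_eigenspace_family_def)
    have "E (\<Sum>m\<in>L. h m) = (\<Sum>m\<in>L. E (h m))"
      by (rule bounded_operatorD(6)[OF E(1)])
    also have "\<dots> = (\<Sum>m\<in>L. if m = l then h m else 0)"
    proof (intro sum.cong refl)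
      fix m assume "m \<in> L"
      then show "E (h m) = (if m = l then h m else 0)"
        using E(2)[of "h m"] E(3)[of m "h m"] Pi_mem[OF that, of m] by auto
    qed
    also have "\<dots> = h l"
      using \<open>finite L\<close> assms(3) by simp
    finally show ?thesis .
  qed
  then show ?thesis
    by (rule that[OF E(1)])
qed

lemma gen_eigenspace_sum_inject:
  assumes "\<And>j. bounded_operator (T j)" and "gen_eigenspace_family T L H"
    and "h \<in> Pi\<^sub>E L H" and "h' \<in> Pi\<^sub>E L H" and "(\<Sum>l\<in>L. h l) = (\<Sum>l\<in>L. h' l)"
  shows "h = h'"
proof (rule PiE_ext[OF assms(3,4)])
  fix l assume "l \<in> L"
  obtain E where E: "bounded_operator E" "\<And>h. h \<in> Pi L H \<Longrightarrow> E (\<Sum>m\<in>L. h m) = h l"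
    using gen_eigenspace_projection[OF assms(1,2) \<open>l \<in> L\<close>] by blast
  have "h \<in> Pi L H" "h' \<in> Pi L H"
    using assms(3,4) by auto
  then show "h l = h' l"
    using E(2)[of h] E(2)[of h'] assms(5) by simp
qed

text \<open>Each T j alone splits vectors along its roots. As the operators commute, splitting along
  one coordinate does not leave the kernels already reached, so the coordinates can be treated one
  at a time.\<close>

lemma gen_eigenspace_decomposition_exists:
  fixes T :: "('d::finite, 'h::complex_hilbert_space) op_tuple"
  assumes T: "\<And>j. bounded_operator (T j)" and alg: "\<And>j. algebraic_operator (T j)"
    and comm: "commuting_tuple T"
  shows "\<exists>L H. gen_eigenspace_decomposition T L H"
proof -
  have T_comm: "T i (T j x) = T j (T i x)" for i j x
    using comm by (simp add: commuting_tuple_def fun_eq_iff)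
  have "\<forall>j. \<exists>R n e. finite R \<and> (\<forall>x. x = (\<Sum>r\<in>R. op_poly (e r) (T j) x)) \<and>
      (\<forall>r\<in>R. \<forall>x. op_poly ([:- r, 1:] ^ n r) (T j) (op_poly (e r) (T j) x) = 0)"
    using algebraic_operator_partial_fractions[OF T alg] by blast
  then obtain R n e where R: "\<And>j. finite (R j)"
    and e_sum: "\<And>j x. (\<Sum>r\<in>R j. op_poly (e j r) (T j) x) = x"
    and e_0: "\<And>j r x. r \<in> R j \<Longrightarrow>
      op_poly ([:- r, 1:] ^ n j r) (T j) (op_poly (e j r) (T j) x) = 0"
    by metis
  define N where "N = (\<lambda>j r. op_poly ([:- r, 1:] ^ n j r) (T j))"
  have N: "bounded_operator (N j r)" for j r
    unfolding N_def by (intro bounded_operator_op_poly T)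
  have op_poly_T: "op_poly q (T j) (T i x) = T i (op_poly q (T j) x)" for i j q x
    by (rule op_poly_commute[symmetric]) (simp_all add: T T_comm)
  have N_op_poly: "N i r (op_poly q (T j) x) = op_poly q (T j) (N i r x)" for i j q r x
    by (rule op_poly_commute) (simp_all add: T N, simp add: N_def op_poly_T)
  define L where "L = Pi\<^sub>E UNIV R"
  define H where "H = (\<lambda>l. {x. \<forall>j. N j (l j) x = 0})"
  have fam: "gen_eigenspace_family T L H"
    unfolding gen_eigenspace_family_def
  proof (intro conjI ballI allI)
    show "finite L"
      unfolding L_def using R by (intro finite_PiE) auto
    fix l assume "l \<in> L"
    show "complex_vs.subspace (H l)"
      by (rule complex_vs.subspaceI) (auto simp: H_def bounded_operatorD[OF N])
    fix j
    show "T j ` H l \<subseteq> H l"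
    proof (clarsimp simp: H_def)
      fix x i assume "\<forall>i. N i (l i) x = 0"
      then show "N i (l i) (T j x) = 0"
        using bounded_operatorD(4)[OF T] by (simp add: N_def op_poly_T)
    qed
    show "\<exists>k. \<forall>x\<in>H l. ((\<lambda>y. T j y - scaleC (l j) y) ^^ k) x = 0"
      by (rule exI[of _ "n j (l j)"]) (simp add: H_def N_def op_poly_linear_power[OF T])
  qed
  \<comment> \<open>Induction over the set of coordinates already split. Indices are extensional
    functions on \<open>F\<close>, so that each one occurs once in the sum.\<close>
  have spanning: "\<exists>h. x = (\<Sum>l\<in>Pi\<^sub>E F R. h l) \<and> (\<forall>l\<in>Pi\<^sub>E F R. \<forall>j\<in>F. N j (l j) (h l) = 0)"
    if "finite F" for F x
    using that
  proof (induction F)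
    case empty
    then show ?case
      by (intro exI[of _ "\<lambda>_. x"]) simp
  next
    case (insert j F)
    then obtain h where h: "x = (\<Sum>l\<in>Pi\<^sub>E F R. h l)"
      "\<And>l i. l \<in> Pi\<^sub>E F R \<Longrightarrow> i \<in> F \<Longrightarrow> N i (l i) (h l) = 0"
      by blast
    \<comment> \<open>The component at the restricted index is split further along the root
      \<open>l j\<close> of \<open>T j\<close>.\<close>
    define h' where "h' = (\<lambda>l. op_poly (e j (l j)) (T j) (h (restrict l F)))"
    have restrict: "restrict (l(j := r)) F = l" if "l \<in> Pi\<^sub>E F R" for l r
      using that insert.hyps
      by (auto simp: fun_eq_iff PiE_def extensional_def restrict_def)
    have "(\<Sum>l\<in>Pi\<^sub>E (insert j F) R. h' l) = (\<Sum>(r, l)\<in>R j \<times> Pi\<^sub>E F R. h' (l(j := r)))"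
      unfolding PiE_insert_eq using insert.hyps
      by (subst sum.reindex) (auto intro!: inj_combinator sum.cong)
    also have "\<dots> = (\<Sum>r\<in>R j. \<Sum>l\<in>Pi\<^sub>E F R. op_poly (e j r) (T j) (h l))"
      by (simp add: sum.cartesian_product[symmetric] h'_def restrict cong: sum.cong)
    also have "\<dots> = (\<Sum>l\<in>Pi\<^sub>E F R. \<Sum>r\<in>R j. op_poly (e j r) (T j) (h l))"
      by (rule sum.swap)
    also have "\<dots> = x"
      by (simp add: e_sum h(1))
    finally have "x = (\<Sum>l\<in>Pi\<^sub>E (insert j F) R. h' l)" ..
    moreover have "N i (l i) (h' l) = 0" if l: "l \<in> Pi\<^sub>E (insert j F) R" and "i \<in> insert j F" for l i
    proof (cases "i = j")
      case True
      then show ?thesis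
        using e_0[of "l j" j] l by (auto simp: h'_def N_def)
    next
      case False
      then have "i \<in> F" "restrict l F \<in> Pi\<^sub>E F R"
        using that by auto
      then have "N i (l i) (h (restrict l F)) = 0"
        using h(2)[of "restrict l F" i] by simp
      \<comment> \<open>\<open>N i\<close> commutes with polynomials in \<open>T j\<close>, so the
        equations for earlier coordinates survive the new splitting.\<close>
      then show ?thesis
        using bounded_operatorD(4)[OF bounded_operator_op_poly[OF T]] by (simp add: h'_def N_op_poly)
    qed
    ultimately show ?case by blast
  qed
  have "is_direct_sum L H"
    unfolding is_direct_sum_def
  proof
    fix x
    obtain h where h: "x = (\<Sum>l\<in>L. h l)" "\<And>l j. l \<in> L \<Longrightarrow> N j (l j) (h l) = 0"
      using spanning[of UNIV x] by (auto simp: L_def)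
    show "\<exists>!h. h \<in> Pi\<^sub>E L H \<and> x = (\<Sum>l\<in>L. h l)"
    proof (rule ex1I)
      show "restrict h L \<in> Pi\<^sub>E L H \<and> x = (\<Sum>l\<in>L. restrict h L l)"
        using h by (auto simp: H_def)
      then show "h' = restrict h L" if "h' \<in> Pi\<^sub>E L H \<and> x = (\<Sum>l\<in>L. h' l)" for h'
        using that by (intro gen_eigenspace_sum_inject[OF T fam]) auto
    qed
  qed
  moreover have "closed (H l)" for l
  proof -
    have "closed {x. N j (l j) x = 0}" for j
      by (intro closed_Collect_eq continuous_intros linear_continuous_on bounded_operatorD(1)[OF N])
    then show ?thesis
      by (auto simp: H_def intro: closed_Collect_all)
  qed
  ultimately have "gen_eigenspace_decomposition T L H"
    using fam unfolding gen_eigenspace_decomposition_def gen_eigenspace_family_def by blast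
  then show ?thesis by blast
qed

section \<open>Projections of a decomposition and the semisimple tuple\<close>

lemma summand_proj_eqI:
  assumes "is_direct_sum L H" and "h \<in> Pi L H" and "x = (\<Sum>m\<in>L. h m)" and "l \<in> L"
  shows "summand_proj L H l x = h l"
proof -
  have "(THE h. h \<in> Pi\<^sub>E L H \<and> x = (\<Sum>m\<in>L. h m)) = restrict h L"
  proof (rule the1_equality)
    show "\<exists>!h. h \<in> Pi\<^sub>E L H \<and> x = (\<Sum>m\<in>L. h m)"
      using assms(1) by (simp add: is_direct_sum_def)
    show "restrict h L \<in> Pi\<^sub>E L H \<and> x = (\<Sum>m\<in>L. restrict h L m)"
      using assms(2,3) by auto
  qed
  then show ?thesis
    using assms(4) by (simp add: summand_proj_def)
qed

lemma summand_proj_decomposition: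
  assumes "is_direct_sum L H"
  shows "(\<Sum>l\<in>L. summand_proj L H l x) = x" and "l \<in> L \<Longrightarrow> summand_proj L H l x \<in> H l"
proof -
  obtain h where h: "h \<in> Pi\<^sub>E L H" "x = (\<Sum>m\<in>L. h m)"
    using assms unfolding is_direct_sum_def by blast
  then have "summand_proj L H m x = h m" if "m \<in> L" for m
    using that by (intro summand_proj_eqI[OF assms, where h = h]) auto
  then show "(\<Sum>l\<in>L. summand_proj L H l x) = x" "l \<in> L \<Longrightarrow> summand_proj L H l x \<in> H l"
    using h by auto
qed

lemma summand_proj_of_mem:
  assumes "gen_eigenspace_decomposition T L H" and "m \<in> L" and "x \<in> H m" and "l \<in> L"
  shows "summand_proj L H l x = (if l = m then x else 0)"
  using assms unfolding gen_eigenspace_decomposition_def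
  by (intro summand_proj_eqI[where h = "\<lambda>l. if l = m then x else 0"])
    (auto simp: complex_vs.subspace_0)

lemma bounded_operator_summand_proj:
  assumes "\<And>j. bounded_operator (T j)" and "gen_eigenspace_decomposition T L H" and "l \<in> L"
  shows "bounded_operator (summand_proj L H l)"
proof -
  obtain E where E: "bounded_operator E" "\<And>h. h \<in> Pi L H \<Longrightarrow> E (\<Sum>m\<in>L. h m) = h l"
    using gen_eigenspace_projection[OF assms(1) gen_eigenspace_decomposition_family[OF assms(2)] assms(3)]
    by blast
  have ds: "is_direct_sum L H"
    using assms(2) by (simp add: gen_eigenspace_decomposition_def)
  have "summand_proj L H l x = E x" for x
    using E(2)[of "\<lambda>m. summand_proj L H m x"] summand_proj_decomposition[OF ds] by auto
  then have "summand_proj L H l = E" ..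
  with E(1) show ?thesis by simp
qed

text \<open>The summands are invariant, so applying T j to the components of x gives the components
  of T j x.\<close>

lemma summand_proj_commute:
  assumes "\<And>j. bounded_operator (T j)" and "gen_eigenspace_decomposition T L H" and "l \<in> L"
  shows "summand_proj L H l (T j x) = T j (summand_proj L H l x)"
proof (rule summand_proj_eqI[where h = "\<lambda>m. T j (summand_proj L H m x)"])
  show ds: "is_direct_sum L H"
    using assms(2) by (simp add: gen_eigenspace_decomposition_def)
  show "(\<lambda>m. T j (summand_proj L H m x)) \<in> Pi L H"
    using assms(2) summand_proj_decomposition(2)[OF ds]
    unfolding gen_eigenspace_decomposition_def by blast
  show "T j x = (\<Sum>m\<in>L. T j (summand_proj L H m x))"
    using bounded_operatorD(6)[OF assms(1), of j "\<lambda>m. summand_proj L H m x" L]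
    by (simp add: summand_proj_decomposition(1)[OF ds])
qed fact

text \<open>The decomposition behind the chosen tuple is returned together with the properties of
  the tuple, because T and its semisimple tuple have to be compared on the same summands.\<close>

lemma semisimple_tuple_decomposition:
  fixes T :: "('d::finite, 'h::complex_hilbert_space) op_tuple"
  assumes T: "\<And>j. bounded_operator (T j)" and "\<And>j. algebraic_operator (T j)"
    and "commuting_tuple T"
  obtains L H where "gen_eigenspace_decomposition T L H"
    and "\<And>j. bounded_operator (semisimple_tuple T j)"
    and "commuting_tuple (semisimple_tuple T)"
    and "\<And>j l x. l \<in> L \<Longrightarrow> x \<in> H l \<Longrightarrow> semisimple_tuple T j x = scaleC (l j) x"
proof -
  have "\<exists>S L H. gen_eigenspace_decomposition T L H \<and>
      S = (\<lambda>j x. \<Sum>l\<in>L. scaleC (l j) (summand_proj L H l x))"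
    using gen_eigenspace_decomposition_exists[OF assms] by blast
  then have "\<exists>L H. gen_eigenspace_decomposition T L H \<and>
      semisimple_tuple T = (\<lambda>j x. \<Sum>l\<in>L. scaleC (l j) (summand_proj L H l x))"
    unfolding semisimple_tuple_def by (rule someI_ex)
  then obtain L H where dec: "gen_eigenspace_decomposition T L H"
    and S: "semisimple_tuple T = (\<lambda>j x. \<Sum>l\<in>L. scaleC (l j) (summand_proj L H l x))"
    by blast
  have ds: "is_direct_sum L H" and sub: "\<And>l. l \<in> L \<Longrightarrow> complex_vs.subspace (H l)"
    and fin: "finite L"
    using dec by (simp_all add: gen_eigenspace_decomposition_def)
  have S_bounded: "bounded_operator (semisimple_tuple T j)" for j
    unfolding S by (intro bounded_operator_sum bounded_operator_scaleC
        bounded_operator_summand_proj[OF T dec])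
  have S_H: "semisimple_tuple T j x = scaleC (l j) x" if "l \<in> L" "x \<in> H l" for j l x
  proof -
    have "semisimple_tuple T j x = (\<Sum>m\<in>L. if m = l then scaleC (l j) x else 0)"
      unfolding S by (intro sum.cong) (auto simp: summand_proj_of_mem[OF dec that])
    then show ?thesis
      using fin that by simp
  qed
  have "semisimple_tuple T i (semisimple_tuple T j x) = semisimple_tuple T j (semisimple_tuple T i x)"
    for i j x
  proof -
    \<comment> \<open>Products are diagonal on the summands with eigenvalue
      \<open>l i * l j\<close>, which is symmetric in i and j.\<close>
    have S_sum: "semisimple_tuple T i (semisimple_tuple T j x) =
        (\<Sum>l\<in>L. scaleC (l i * l j) (summand_proj L H l x))" for i j
    proof -
      have "semisimple_tuple T i (semisimple_tuple T j x) =
          (\<Sum>l\<in>L. semisimple_tuple T i (scaleC (l j) (summand_proj L H l x)))"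
        by (subst (2) S) (rule bounded_operatorD(6)[OF S_bounded])
      also have "\<dots> = (\<Sum>l\<in>L. scaleC (l i * l j) (summand_proj L H l x))"
        by (intro sum.cong) (simp_all add: S_H summand_proj_decomposition(2)[OF ds]
            complex_vs.subspace_scale[OF sub])
      finally show ?thesis .
    qed
    show ?thesis
      unfolding S_sum by (simp add: mult.commute)
  qed
  then have S_comm: "commuting_tuple (semisimple_tuple T)"
    by (simp add: commuting_tuple_def fun_eq_iff)
  show ?thesis
    by (intro that[OF dec S_bounded S_comm] S_H)
qed

subsection \<open>Multivariate polynomials\<close>

lemma poly_mapping_sum_single:
  fixes f :: "'a \<Rightarrow>\<^sub>0 'b::comm_monoid_add"
  shows "(\<Sum>k\<in>Poly_Mapping.keys f. Poly_Mapping.single k (Poly_Mapping.lookup f k)) = f"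
proof (rule poly_mapping_eqI)
  fix a
  show "Poly_Mapping.lookup (\<Sum>k\<in>Poly_Mapping.keys f.
      Poly_Mapping.single k (Poly_Mapping.lookup f k)) a = Poly_Mapping.lookup f a"
    by (simp add: lookup_sum lookup_single when_def in_keys_iff)
qed

text \<open>The linear extension of values prescribed on monomials. If \<omega> turns sums of
  exponents into products and 0 into 1, it is substitution of a point.\<close>

definition pm_eval :: "('a \<Rightarrow> 'b) \<Rightarrow> ('a \<Rightarrow>\<^sub>0 'b::comm_semiring_1) \<Rightarrow> 'b"
  where "pm_eval \<omega> f = (\<Sum>k\<in>Poly_Mapping.keys f. Poly_Mapping.lookup f k * \<omega> k)"

lemma pm_eval_add: "pm_eval \<omega> (f + g) = pm_eval \<omega> f + pm_eval \<omega> g"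
  unfolding pm_eval_def
  by (rule setsum_keys_plus_distrib[where f = "\<lambda>k c. c * \<omega> k"]) (simp_all add: distrib_right)

lemma pm_eval_sum: "pm_eval \<omega> (sum g I) = (\<Sum>i\<in>I. pm_eval \<omega> (g i))"
  by (induction I rule: infinite_finite_induct) (simp_all add: pm_eval_add, simp_all add: pm_eval_def)

lemma pm_eval_single: "pm_eval \<omega> (Poly_Mapping.single k c) = c * \<omega> k"
  by (simp add: pm_eval_def)

lemma pm_eval_mult:
  fixes \<omega> :: "'a::monoid_add \<Rightarrow> 'b::comm_semiring_1"
  assumes "\<And>a b. \<omega> (a + b) = \<omega> a * \<omega> b"
  shows "pm_eval \<omega> (f * g) = pm_eval \<omega> f * pm_eval \<omega> g"
proof -
  have "f * g = (\<Sum>a\<in>Poly_Mapping.keys f. \<Sum>b\<in>Poly_Mapping.keys g.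
      Poly_Mapping.single (a + b) (Poly_Mapping.lookup f a * Poly_Mapping.lookup g b))"
    by (subst (1) poly_mapping_sum_single[of f, symmetric],
        subst (1) poly_mapping_sum_single[of g, symmetric])
      (simp only: sum_product mult_single)
  then have "pm_eval \<omega> (f * g) = (\<Sum>a\<in>Poly_Mapping.keys f. \<Sum>b\<in>Poly_Mapping.keys g.
      (Poly_Mapping.lookup f a * \<omega> a) * (Poly_Mapping.lookup g b * \<omega> b))"
    by (simp add: pm_eval_sum pm_eval_single assms ac_simps)
  then show ?thesis
    by (simp only: pm_eval_def sum_product)
qed

lemma pm_eval_power:
  fixes \<omega> :: "'a::monoid_add \<Rightarrow> 'b::comm_semiring_1"
  assumes "\<And>a b. \<omega> (a + b) = \<omega> a * \<omega> b" and "\<omega> 0 = 1"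
  shows "pm_eval \<omega> (f ^ n) = pm_eval \<omega> f ^ n"
proof (induction n)
  case 0
  have "pm_eval \<omega> 1 = 1"
    using assms(2) by (simp add: pm_eval_def lookup_one)
  then show ?case by simp
qed (simp add: pm_eval_mult[OF assms(1)])

section \<open>Monomials evaluated at points and at commuting tuples\<close>

definition monomial_value :: "('d::finite \<Rightarrow> complex) \<Rightarrow> 'd multiindex \<Rightarrow> complex"
  where "monomial_value c \<alpha> = (\<Prod>j\<in>UNIV. c j ^ Poly_Mapping.lookup \<alpha> j)"

lemma monomial_value_add: "monomial_value c (\<alpha> + \<beta>) = monomial_value c \<alpha> * monomial_value c \<beta>"
  by (simp add: monomial_value_def lookup_add power_add prod.distrib)

lemma monomial_value_0: "monomial_value c 0 = 1"
  by (simp add: monomial_value_def)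

text \<open>The first block of variables is conjugated because the monomials in it enter
  the evaluation through their adjoints.\<close>
definition bimonomial_value ::
    "('d::finite \<Rightarrow> complex) \<Rightarrow> ('d \<Rightarrow> complex) \<Rightarrow> 'd multiindex \<times> 'd multiindex \<Rightarrow> complex"
  where "bimonomial_value l m = (\<lambda>(\<alpha>, \<beta>). cnj (monomial_value l \<alpha>) * monomial_value m \<beta>)"

text \<open>The weight is multiplicative in the exponents, so \<open>pm_eval\<close> evaluates
  polynomials at the point (cnj l, m). A power of p thus becomes a power of a complex
  number.\<close>

lemma pm_eval_bimonomial_power:
  "pm_eval (bimonomial_value l m) (f ^ n) = pm_eval (bimonomial_value l m) f ^ n"
  by (rule pm_eval_power)
    (auto simp: bimonomial_value_def monomial_value_add monomial_value_0 zero_prod_def)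

text \<open>The fold is unfolded here once, for properties stable under left composition with the X
  j. The exponents disappear from the induction, which is why \<open>op_monomial_weight\<close> runs
  its own.\<close>

lemma op_monomial_induct:
  fixes X :: "('d::finite, 'h) op_tuple"
  assumes "commuting_tuple X" and "P (\<lambda>x. x)" and "\<And>j Q. P Q \<Longrightarrow> P (\<lambda>x. X j (Q x))"
  shows "P (op_monomial X \<alpha>)"
proof -
  define M where "M = Finite_Set.fold (\<lambda>j P. (X j ^^ Poly_Mapping.lookup \<alpha> j) \<circ> P) id"
  have M_insert: "M (insert j F) = (X j ^^ Poly_Mapping.lookup \<alpha> j) \<circ> M F"
    if "finite F" "j \<notin> F" for j F
    unfolding M_def by (rule op_monomial_fold_insert[OF assms(1) that(2,1)])
  have M_empty: "M {} = id"
    by (simp add: M_def)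
  have step: "P (X j \<circ> Q)" if "P Q" for j Q
    using assms(3)[OF that] by (simp add: comp_def)
  have "P (M F)" if "finite F" for F
    using that
  proof (induction F)
    case empty
    then show ?case
      using assms(2) by (simp add: M_empty id_def)
  next
    case (insert j F)
    have "P ((X j ^^ n) \<circ> M F)" for n
    proof (induction n)
      case (Suc n)
      have "(X j ^^ Suc n) \<circ> M F = X j \<circ> ((X j ^^ n) \<circ> M F)"
        by (simp add: o_assoc)
      with step[OF Suc, of j] show ?case
        by (simp only:)
    qed (use insert.IH in simp)
    then show ?case
      by (simp only: M_insert[OF insert.hyps])
  qed
  then have "P (M UNIV)"
    by simp
  then show ?thesis
    by (simp only: M_def op_monomial_def)
qed

lemma bounded_operator_op_monomial:
  assumes "commuting_tuple X" and "\<And>j. bounded_operator (X j)"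
  shows "bounded_operator (op_monomial X \<alpha>)"
  by (rule op_monomial_induct[OF assms(1)])
    (simp_all add: bounded_operator_id bounded_operator_compose[OF assms(2)])

lemma op_monomial_commute:
  assumes "commuting_tuple X" and "\<And>j x. S (X j x) = X j (S x)"
  shows "S (op_monomial X \<alpha> x) = op_monomial X \<alpha> (S x)"
proof -
  have "\<forall>x. S (op_monomial X \<alpha> x) = op_monomial X \<alpha> (S x)"
    by (rule op_monomial_induct[OF assms(1), where P = "\<lambda>Q. \<forall>x. S (Q x) = Q (S x)"])
      (simp_all add: assms(2))
  then show ?thesis ..
qed

text \<open>The map g is an arbitrary weight vector for the tuple, and s describes how scalars act on
  its values; this covers joint eigenvectors and both arguments of a sesquilinear form.\<close>
lemma op_monomial_weight:
  fixes X :: "('d::finite, 'h) op_tuple" and s :: "complex \<Rightarrow> 'b \<Rightarrow> 'b"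
  assumes "commuting_tuple X"
    and s: "\<And>z. s 1 z = z" "\<And>a b z. s a (s b z) = s (a * b) z"
    and V: "\<And>j x. x \<in> V \<Longrightarrow> X j x \<in> V"
    and g: "\<And>j x. x \<in> V \<Longrightarrow> g (X j x) = s (c j) (g x)"
    and "x \<in> V"
  shows "g (op_monomial X \<alpha> x) = s (monomial_value c \<alpha>) (g x)"
proof -
  define M where "M = Finite_Set.fold (\<lambda>j P. (X j ^^ Poly_Mapping.lookup \<alpha> j) \<circ> P) id"
  have M_insert: "M (insert j F) = (X j ^^ Poly_Mapping.lookup \<alpha> j) \<circ> M F"
    if "finite F" "j \<notin> F" for j F
    unfolding M_def by (rule op_monomial_fold_insert[OF assms(1) that(2,1)])
  have M_empty: "M {} = id"
    by (simp add: M_def)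
  have pow: "(X j ^^ n) x \<in> V \<and> g ((X j ^^ n) x) = s (c j ^ n) (g x)" if "x \<in> V" for j n x
    by (induction n) (simp_all add: that V g s)
  have "M F x \<in> V \<and> g (M F x) = s (\<Prod>j\<in>F. c j ^ Poly_Mapping.lookup \<alpha> j) (g x)"
    if "finite F" for F
    using that
  proof (induction F)
    case (insert j F)
    then show ?case
      using pow[of "M F x" "Poly_Mapping.lookup \<alpha> j" j]
      using insert.hyps by (simp add: M_insert s insert.IH)
  qed (simp add: M_empty s \<open>x \<in> V\<close>)
  then have "g (M UNIV x) = s (monomial_value c \<alpha>) (g x)"
    by (simp add: monomial_value_def)
  then show ?thesis
    by (simp only: M_def op_monomial_def)
qed

lemma cinner_op_poly_eval:
  assumes "commuting_tuple X" and "\<And>j. bounded_operator (X j)"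
  shows "cinner (op_poly_eval f A X Y h) k = (\<Sum>(\<alpha>, \<beta>)\<in>Poly_Mapping.keys f.
    Poly_Mapping.lookup f (\<alpha>, \<beta>) * cinner (A (op_monomial Y \<beta> h)) (op_monomial X \<alpha> k))"
proof -
  have "cinner (hilbert_adjoint (op_monomial X \<alpha>) y) k = cinner y (op_monomial X \<alpha> k)" for \<alpha> y
    using cinner_hilbert_adjoint[OF bounded_operator_op_monomial[OF assms], of k \<alpha> y]
    by (metis cinner_commute)
  then show ?thesis
    by (simp add: op_poly_eval_def cinner_sum_left cinner_scaleC_left case_prod_unfold)
qed

text \<open>An operator is zero when all its matrix coefficients are. Moving the adjoints to the
  second argument makes the condition linear in the form (h, k) \<mapsto> <A h, k>, which can then
  be replaced by other forms.\<close>

lemma mem_J_ideal_iff: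
  assumes "commuting_tuple X" and "\<And>j. bounded_operator (X j)"
  shows "f \<in> J_ideal A X Y \<longleftrightarrow> (\<forall>h k. (\<Sum>(\<alpha>, \<beta>)\<in>Poly_Mapping.keys f.
    Poly_Mapping.lookup f (\<alpha>, \<beta>) * cinner (A (op_monomial Y \<beta> h)) (op_monomial X \<alpha> k)) = 0)"
proof -
  have "f \<in> J_ideal A X Y \<longleftrightarrow> (\<forall>h k. cinner (op_poly_eval f A X Y h) k = 0)"
    unfolding J_ideal_def by (auto simp: fun_eq_iff) (metis cinner_self_eq_0_iff)
  then show ?thesis
    by (simp only: cinner_op_poly_eval[OF assms])
qed

subsection \<open>Nilpotent actions on sesquilinear forms\<close>

text \<open>For each new N j, the point w is replaced by its last iterate under N j that differs
  from z; commutation preserves the equations already obtained. The point z stands for zero, and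
  only iteration is used, so the result applies to forms as plain functions.\<close>

lemma common_kernel_of_commuting_nilpotents:
  assumes "finite I" and "v \<in> W" and "v \<noteq> z"
    and W: "\<And>i w. i \<in> I \<Longrightarrow> w \<in> W \<Longrightarrow> N i w \<in> W" and z: "\<And>i. i \<in> I \<Longrightarrow> N i z = z"
    and comm: "\<And>i j w. i \<in> I \<Longrightarrow> j \<in> I \<Longrightarrow> w \<in> W \<Longrightarrow> N i (N j w) = N j (N i w)"
    and nil: "\<And>i w. i \<in> I \<Longrightarrow> w \<in> W \<Longrightarrow> \<exists>n. (N i ^^ n) w = z"
  shows "\<exists>w\<in>W. w \<noteq> z \<and> (\<forall>i\<in>I. N i w = z)"
proof -
  have "\<exists>w\<in>W. w \<noteq> z \<and> (\<forall>i\<in>J. N i w = z)" if "finite J" "J \<subseteq> I" for J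
    using that
  proof (induction J)
    case empty
    then show ?case
      using assms(2,3) by blast
  next
    case (insert j J)
    then obtain w where w: "w \<in> W" "w \<noteq> z" "\<And>i. i \<in> J \<Longrightarrow> N i w = z"
      by blast
    have j: "j \<in> I" and J: "\<And>i. i \<in> J \<Longrightarrow> i \<in> I"
      using insert.prems by auto
    define n where "n = (LEAST n. (N j ^^ n) w = z)"
    have n: "(N j ^^ n) w = z"
      unfolding n_def using nil[OF j w(1)] by (rule LeastI_ex)
    \<comment> \<open>As \<open>w\<close> differs from \<open>z\<close>, the least exponent is
      positive; the iterate just before it is the new witness.\<close>
    then obtain m where m: "n = Suc m"
      using w(2) by (cases n) auto
    have powW: "(N j ^^ k) w \<in> W" for k
      by (induction k) (simp_all add: w(1) W[OF j])
    have "N i ((N j ^^ k) w) = z" if "i \<in> J" for i k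
      by (induction k) (simp_all add: w(3) that comm[OF J j powW] z[OF j])
    moreover have "(N j ^^ m) w \<noteq> z"
      using not_less_Least[of m "\<lambda>n. (N j ^^ n) w = z"] m by (simp add: n_def)
    moreover have "N j ((N j ^^ m) w) = z"
      using n m by simp
    ultimately show ?case
      using powW by blast
  qed
  with assms(1) show ?thesis by blast
qed


text \<open>On a nonzero form annihilated by all the shifted operators, monomials act as scalars, so
  the polynomial relation becomes one scalar times the form. The relation survives the passage from
  B to that form because the shifted operators commute with the monomials of their tuple.\<close>

lemma nilpotent_sesquilinear_form_weight:
  fixes X Y :: "('d::finite, 'h::complex_hilbert_space) op_tuple"
  assumes X: "\<And>j. bounded_operator (X j)" "commuting_tuple X"
    and Y: "\<And>j. bounded_operator (Y j)" "commuting_tuple Y"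
    and B: "\<And>x y k. B (x - y) k = B x k - B y k" "\<And>c x k. B (scaleC c x) k = c * B x k"
      "\<And>h x y. B h (x - y) = B h x - B h y" "\<And>c h x. B h (scaleC c x) = cnj c * B h x"
    and nilX: "\<And>j. \<exists>n. \<forall>h k. B h (((\<lambda>y. X j y - scaleC (l j) y) ^^ n) k) = 0"
    and nilY: "\<And>j. \<exists>n. \<forall>h k. B (((\<lambda>y. Y j y - scaleC (m j) y) ^^ n) h) k = 0"
    and ann: "\<And>h k. (\<Sum>(\<alpha>, \<beta>)\<in>Poly_Mapping.keys f. Poly_Mapping.lookup f (\<alpha>, \<beta>) *
      B (op_monomial Y \<beta> h) (op_monomial X \<alpha> k)) = 0"
  shows "pm_eval (bimonomial_value l m) f = 0 \<or> (\<forall>h k. B h k = 0)"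
proof (rule disjCI)
  assume nonzero: "\<not> (\<forall>h k. B h k = 0)"
  define C where "C = (\<lambda>j y. X j y - scaleC (l j) y)"
  define D where "D = (\<lambda>j y. Y j y - scaleC (m j) y)"
  have C: "bounded_operator (C j)" and D: "bounded_operator (D j)" for j
    unfolding C_def D_def by (intro bounded_operator_diff_scaleC X(1) Y(1))+
  have X_comm: "X i (X j x) = X j (X i x)" for i j x
    using X(2) by (simp add: commuting_tuple_def fun_eq_iff)
  have Y_comm: "Y i (Y j x) = Y j (Y i x)" for i j x
    using Y(2) by (simp add: commuting_tuple_def fun_eq_iff)
  have C_X: "C i (X j x) = X j (C i x)" for i j x
    by (simp add: C_def X_comm bounded_operatorD[OF X(1)])
  have D_Y: "D i (Y j x) = Y j (D i x)" for i j x
    by (simp add: D_def Y_comm bounded_operatorD[OF Y(1)])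
  have C_C: "C i (C j x) = C j (C i x)" for i j x
    by (simp add: C_def X_comm bounded_operatorD[OF X(1)] complex_vs.scale_right_diff_distrib
        complex_vs.scale_left_commute)
  have D_D: "D i (D j x) = D j (D i x)" for i j x
    by (simp add: D_def Y_comm bounded_operatorD[OF Y(1)] complex_vs.scale_right_diff_distrib
        complex_vs.scale_left_commute)
  have C_pow: "(C i ^^ n) (C j x) = C j ((C i ^^ n) x)" for i j n x
    by (induction n) (simp_all add: C_C[of i j])
  have D_pow: "(D i ^^ n) (D j x) = D j ((D i ^^ n) x)" for i j n x
    by (induction n) (simp_all add: D_D[of i j])
  have C_diff: "C j (x - y) = C j x - C j y" and C_scale: "C j (scaleC c x) = scaleC c (C j x)"
    for j x y c
    by (rule bounded_operatorD(3)[OF C]) (rule bounded_operatorD(5)[OF C])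
  have D_diff: "D j (x - y) = D j x - D j y" and D_scale: "D j (scaleC c x) = scaleC c (D j x)"
    for j x y c
    by (rule bounded_operatorD(3)[OF D]) (rule bounded_operatorD(5)[OF D])
  have C_mono: "C j (op_monomial X \<alpha> x) = op_monomial X \<alpha> (C j x)" for j \<alpha> x
    by (rule op_monomial_commute[where S = "C j", OF X(2)]) (rule C_X)
  have D_mono: "D j (op_monomial Y \<alpha> x) = op_monomial Y \<alpha> (D j x)" for j \<alpha> x
    by (rule op_monomial_commute[where S = "D j", OF Y(2)]) (rule D_Y)
  \<comment> \<open>The sum type collects both families: \<open>Inl\<close> acts on the second
    argument through X, \<open>Inr\<close> on the first through Y. Mixed pairs commute because they
    touch different arguments.\<close>
  define N where "N = case_sum (\<lambda>j b h k. b h (C j k) :: complex) (\<lambda>j b h k. b (D j h) k)"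
  have N_simps: "N (Inl j) b = (\<lambda>h k. b h (C j k))" "N (Inr j) b = (\<lambda>h k. b (D j h) k)" for j b
    by (simp_all add: N_def)
  define sesq :: "('h \<Rightarrow> 'h \<Rightarrow> complex) \<Rightarrow> bool" where "sesq = (\<lambda>b. (\<forall>x y k. b (x - y) k = b x k - b y k) \<and>
    (\<forall>c x k. b (scaleC c x) k = c * b x k) \<and> (\<forall>h x y. b h (x - y) = b h x - b h y) \<and>
    (\<forall>c h x. b h (scaleC c x) = cnj c * (b h x :: complex)))"
  \<comment> \<open>The exponents are uniform in \<open>h\<close> and \<open>k\<close>, so that a
    power of the action gives the zero form.\<close>
  define nilp :: "('h \<Rightarrow> 'h \<Rightarrow> complex) \<Rightarrow> bool" where "nilp = (\<lambda>b. (\<forall>j. \<exists>n. \<forall>h k. b h ((C j ^^ n) k) = (0 :: complex)) \<and>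
    (\<forall>j. \<exists>n. \<forall>h k. b ((D j ^^ n) h) k = 0))"
  define annih :: "('h \<Rightarrow> 'h \<Rightarrow> complex) \<Rightarrow> bool" where "annih = (\<lambda>b. \<forall>h k. (\<Sum>(\<alpha>, \<beta>)\<in>Poly_Mapping.keys f.
    Poly_Mapping.lookup f (\<alpha>, \<beta>) * b (op_monomial Y \<beta> h) (op_monomial X \<alpha> k)) = 0)"
  define W where "W = {b. sesq b \<and> nilp b \<and> annih b}"
  have "\<exists>b\<in>W. b \<noteq> (\<lambda>h k. 0) \<and> (\<forall>i\<in>UNIV. N i b = (\<lambda>h k. 0))"
  proof (rule common_kernel_of_commuting_nilpotents)
    show "B \<in> W"
      using B nilX nilY ann by (simp add: W_def sesq_def nilp_def annih_def C_def D_def)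
    show "B \<noteq> (\<lambda>h k. 0)"
      using nonzero by (auto simp: fun_eq_iff)
  next
    fix i b assume "b \<in> W"
    then have b: "sesq b" "nilp b" "annih b"
      by (simp_all add: W_def)
    have "sesq (N i b)"
      using b(1) by (cases i) (simp_all add: sesq_def N_simps C_diff C_scale D_diff D_scale)
    \<comment> \<open>The old exponents still serve: an added \<open>C j\<close> or
      \<open>D j\<close> moves past the powers onto the free vector.\<close>
    moreover have "nilp (N i b)"
      using b(2) by (cases i) (simp_all add: nilp_def N_simps flip: C_pow D_pow, meson+)
    moreover have "annih (N i b)"
      using b(3) by (cases i) (simp_all add: annih_def N_simps C_mono D_mono)
    ultimately show "N i b \<in> W"
      by (simp add: W_def)
    show "\<exists>n. (N i ^^ n) b = (\<lambda>h k. 0)"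
    proof (cases i)
      case (Inl j)
      have "(N i ^^ n) b = (\<lambda>h k. b h ((C j ^^ n) k))" for n
        by (induction n) (simp_all add: Inl N_simps funpow_swap1)
      then show ?thesis
        using b(2) by (simp add: nilp_def fun_eq_iff)
    next
      case (Inr j)
      have "(N i ^^ n) b = (\<lambda>h k. b ((D j ^^ n) h) k)" for n
        by (induction n) (simp_all add: Inr N_simps funpow_swap1)
      then show ?thesis
        using b(2) by (simp add: nilp_def fun_eq_iff)
    qed
  next
    show "N i (N j b) = N j (N i b)" for i j b
      by (cases i; cases j) (simp_all add: N_simps C_C D_D)
    show "N i (\<lambda>h k. 0) = (\<lambda>h k. 0)" for i
      by (cases i) (simp_all add: N_simps)
  qed simp
  then obtain b where b: "sesq b" "annih b" "b \<noteq> (\<lambda>h k. 0)"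
    and N0: "\<And>i. N i b = (\<lambda>h k. 0)"
    by (auto simp: W_def)
  \<comment> \<open>Vanishing of \<open>N (Inl j) b\<close> means that b does not distinguish
    \<open>X j k\<close> from \<open>scaleC (l j) k\<close>; the scalar leaves the second argument
    conjugated.\<close>
  have bX: "b h (X j k) = cnj (l j) * b h k" for j h k
    using N0[of "Inl j"] b(1) by (simp add: N_simps C_def sesq_def fun_eq_iff)
  have bY: "b (Y j h) k = m j * b h k" for j h k
    using N0[of "Inr j"] b(1) by (simp add: N_simps D_def sesq_def fun_eq_iff)
  have "b (op_monomial Y \<beta> h) k = monomial_value m \<beta> * b h k" for \<beta> h k
    by (rule op_monomial_weight[OF Y(2), where V = UNIV and g = "\<lambda>h. b h k"]) (simp_all add: bY)
  moreover have "b h (op_monomial X \<alpha> k) = cnj (monomial_value l \<alpha>) * b h k" for \<alpha> h k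
    by (rule op_monomial_weight[OF X(2), where V = UNIV and g = "b h" and s = "\<lambda>c z. cnj c * z"])
      (simp_all add: bX)
  ultimately have "pm_eval (bimonomial_value l m) f * b h k = 0" for h k
    using b(2) by (simp add: annih_def pm_eval_def bimonomial_value_def sum_distrib_right
        case_prod_unfold mult.assoc)
  moreover obtain h k where "b h k \<noteq> 0"
    using b(3) by (auto simp: fun_eq_iff)
  ultimately show "pm_eval (bimonomial_value l m) f = 0"
    by (metis mult_eq_0_iff)
qed

text \<open>Since the projections commute with the tuples, the relation for the projected form at
  (h, k) is the relation for A at the projected vectors. At vectors of the two eigenspaces the
  projections are the identity, which recovers the form of A itself.\<close>

lemma Rad_J_ideal_weight:
  fixes X Y :: "('d::finite, 'h::complex_hilbert_space) op_tuple"
  assumes A: "bounded_operator A"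
    and X: "\<And>j. bounded_operator (X j)" "commuting_tuple X" "gen_eigenspace_decomposition X L H"
    and Y: "\<And>j. bounded_operator (Y j)" "commuting_tuple Y" "gen_eigenspace_decomposition Y M K"
    and p: "p \<in> Rad (J_ideal A X Y)" and l: "l \<in> L" and m: "m \<in> M"
    and h: "h \<in> K m" and k: "k \<in> H l"
  shows "pm_eval (bimonomial_value l m) p * cinner (A h) k = 0"
proof -
  obtain n where n: "p ^ n \<in> J_ideal A X Y"
    using p by (auto simp: Rad_def)
  define P where "P = summand_proj L H l"
  define Q where "Q = summand_proj M K m"
  have P: "bounded_operator P" "\<And>j x. P (X j x) = X j (P x)" "\<And>x. P x \<in> H l"
    using bounded_operator_summand_proj[OF X(1,3) l] summand_proj_commute[OF X(1,3) l]
      summand_proj_decomposition(2)[OF _ l, of H] X(3)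
    by (auto simp: P_def gen_eigenspace_decomposition_def)
  have Q: "bounded_operator Q" "\<And>j x. Q (Y j x) = Y j (Q x)" "\<And>x. Q x \<in> K m"
    using bounded_operator_summand_proj[OF Y(1,3) m] summand_proj_commute[OF Y(1,3) m]
      summand_proj_decomposition(2)[OF _ m, of K] Y(3)
    by (auto simp: Q_def gen_eigenspace_decomposition_def)
  note lin = bounded_operatorD[OF A] bounded_operatorD[OF P(1)] bounded_operatorD[OF Q(1)]
  have P_pow: "P (((\<lambda>y. X j y - scaleC (l j) y) ^^ n) x) = ((\<lambda>y. X j y - scaleC (l j) y) ^^ n) (P x)"
    for j n x
    by (induction n) (simp_all add: lin P(2))
  have Q_pow: "Q (((\<lambda>y. Y j y - scaleC (m j) y) ^^ n) x) = ((\<lambda>y. Y j y - scaleC (m j) y) ^^ n) (Q x)"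
    for j n x
    by (induction n) (simp_all add: lin Q(2))
  have "pm_eval (bimonomial_value l m) (p ^ n) = 0 \<or> (\<forall>h k. cinner (A (Q h)) (P k) = 0)"
  proof (rule nilpotent_sesquilinear_form_weight[OF X(1,2) Y(1,2)])
    fix j
    obtain n where n: "\<And>x. x \<in> H l \<Longrightarrow> ((\<lambda>y. X j y - scaleC (l j) y) ^^ n) x = 0"
      using X(3) l unfolding gen_eigenspace_decomposition_def by meson
    show "\<exists>n. \<forall>h k. cinner (A (Q h)) (P (((\<lambda>y. X j y - scaleC (l j) y) ^^ n) k)) = 0"
      by (rule exI[of _ n]) (simp add: P_pow n P(3))
    obtain n' where n': "\<And>x. x \<in> K m \<Longrightarrow> ((\<lambda>y. Y j y - scaleC (m j) y) ^^ n') x = 0"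
      using Y(3) m unfolding gen_eigenspace_decomposition_def by meson
    show "\<exists>n. \<forall>h k. cinner (A (Q (((\<lambda>y. Y j y - scaleC (m j) y) ^^ n) h))) (P k) = 0"
      by (rule exI[of _ n']) (simp add: Q_pow n' Q(3) lin)
  next
    fix h k
    show "(\<Sum>(\<alpha>, \<beta>)\<in>Poly_Mapping.keys (p ^ n). Poly_Mapping.lookup (p ^ n) (\<alpha>, \<beta>) *
        cinner (A (Q (op_monomial Y \<beta> h))) (P (op_monomial X \<alpha> k))) = 0"
      using n by (simp add: mem_J_ideal_iff[OF X(2,1)] op_monomial_commute[where S = P, OF X(2) P(2)]
          op_monomial_commute[where S = Q, OF Y(2) Q(2)])
  qed (simp_all add: lin cinner_diff_left cinner_diff_right cinner_scaleC_left cinner_scaleC_right)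
  moreover have "Q h = h" "P k = k"
    using summand_proj_of_mem[OF Y(3) m h m] summand_proj_of_mem[OF X(3) l k l]
    by (simp_all add: P_def Q_def)
  \<comment> \<open>A vanishing power of p(cnj l, m) forces p(cnj l, m) to vanish; this is where the
    radical is absorbed.\<close>
  ultimately show ?thesis
    by (metis mult_eq_0_iff pm_eval_bimonomial_power power_not_zero)
qed

theorem theorem2p6:
  fixes A :: "'h::complex_hilbert_space \<Rightarrow> 'h"
    and X Y U V :: "('d::finite, 'h) op_tuple"
  assumes "bounded_operator A"
    and "\<And>j. bounded_operator (X j)" and "\<And>j. algebraic_operator (X j)"
    and "commuting_tuple X"
    and "\<And>j. bounded_operator (Y j)" and "\<And>j. algebraic_operator (Y j)"
    and "commuting_tuple Y"
    and "U = semisimple_tuple X" and "V = semisimple_tuple Y"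
  shows "Rad (J_ideal A X Y) \<subseteq> J_ideal A U V"
proof
  fix p assume p: "p \<in> Rad (J_ideal A X Y)"
  obtain L H where X: "gen_eigenspace_decomposition X L H"
    and U: "\<And>j. bounded_operator (U j)" "commuting_tuple U"
      "\<And>j l x. l \<in> L \<Longrightarrow> x \<in> H l \<Longrightarrow> U j x = scaleC (l j) x"
    unfolding assms(8) using semisimple_tuple_decomposition[OF assms(2-4)] by metis
  obtain M K where Y: "gen_eigenspace_decomposition Y M K"
    and V: "\<And>j. bounded_operator (V j)" "commuting_tuple V"
      "\<And>j m x. m \<in> M \<Longrightarrow> x \<in> K m \<Longrightarrow> V j x = scaleC (m j) x"
    unfolding assms(9) using semisimple_tuple_decomposition[OF assms(5-7)] by metis
  have dsX: "is_direct_sum L H" and dsY: "is_direct_sum M K"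
    using X Y by (simp_all add: gen_eigenspace_decomposition_def)
  define P where "P = summand_proj L H"
  define Q where "Q = summand_proj M K"
  have P: "(\<Sum>l\<in>L. P l k) = k" "l \<in> L \<Longrightarrow> P l k \<in> H l" for k l
    unfolding P_def using summand_proj_decomposition[OF dsX] by auto
  have Q: "(\<Sum>m\<in>M. Q m h) = h" "m \<in> M \<Longrightarrow> Q m h \<in> K m" for h m
    unfolding Q_def using summand_proj_decomposition[OF dsY] by auto
  have U_mono: "op_monomial U \<alpha> k = (\<Sum>l\<in>L. scaleC (monomial_value l \<alpha>) (P l k))" for \<alpha> k
  proof -
    have "op_monomial U \<alpha> k = (\<Sum>l\<in>L. op_monomial U \<alpha> (P l k))"
      using bounded_operatorD(6)[OF bounded_operator_op_monomial[OF U(2,1)], of \<alpha> "\<lambda>l. P l k" L]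
      by (simp add: P(1))
    also have "\<dots> = (\<Sum>l\<in>L. scaleC (monomial_value l \<alpha>) (P l k))"
    proof (intro sum.cong refl)
      fix l assume l: "l \<in> L"
      then have sub: "complex_vs.subspace (H l)"
        using X by (simp add: gen_eigenspace_decomposition_def)
      \<comment> \<open>Here the weight vector map is the identity. The invariant set is
        \<open>H l\<close> because the eigenvalue \<open>l j\<close> is known only there.\<close>
      show "op_monomial U \<alpha> (P l k) = scaleC (monomial_value l \<alpha>) (P l k)"
        by (rule op_monomial_weight[OF U(2), where V = "H l" and g = "\<lambda>x. x"])
          (simp_all add: U(3)[OF l] P(2)[OF l] scaleC_scaleC complex_vs.subspace_scale[OF sub])
    qed
    finally show ?thesis .
  qed
  have V_mono: "op_monomial V \<beta> h = (\<Sum>m\<in>M. scaleC (monomial_value m \<beta>) (Q m h))" for \<beta> h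
  proof -
    have "op_monomial V \<beta> h = (\<Sum>m\<in>M. op_monomial V \<beta> (Q m h))"
      using bounded_operatorD(6)[OF bounded_operator_op_monomial[OF V(2,1)], of \<beta> "\<lambda>m. Q m h" M]
      by (simp add: Q(1))
    also have "\<dots> = (\<Sum>m\<in>M. scaleC (monomial_value m \<beta>) (Q m h))"
    proof (intro sum.cong refl)
      fix m assume m: "m \<in> M"
      then have sub: "complex_vs.subspace (K m)"
        using Y by (simp add: gen_eigenspace_decomposition_def)
      show "op_monomial V \<beta> (Q m h) = scaleC (monomial_value m \<beta>) (Q m h)"
        by (rule op_monomial_weight[OF V(2), where V = "K m" and g = "\<lambda>x. x"])
          (simp_all add: V(3)[OF m] Q(2)[OF m] scaleC_scaleC complex_vs.subspace_scale[OF sub])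
    qed
    finally show ?thesis .
  qed
  have "(\<Sum>(\<alpha>, \<beta>)\<in>Poly_Mapping.keys p. Poly_Mapping.lookup p (\<alpha>, \<beta>) *
      cinner (A (op_monomial V \<beta> h)) (op_monomial U \<alpha> k)) = 0" for h k
  proof -
    have "cinner (A (op_monomial V \<beta> h)) (op_monomial U \<alpha> k) =
        (\<Sum>m\<in>M. \<Sum>l\<in>L. bimonomial_value l m (\<alpha>, \<beta>) * cinner (A (Q m h)) (P l k))" for \<alpha> \<beta>
      unfolding U_mono V_mono bounded_operatorD(6)[OF assms(1)] cinner_sum_left
      by (simp add: bounded_operatorD(5)[OF assms(1)] cinner_sum_right
          cinner_scaleC_left cinner_scaleC_right bimonomial_value_def ac_simps)
    then have "(\<Sum>(\<alpha>, \<beta>)\<in>Poly_Mapping.keys p. Poly_Mapping.lookup p (\<alpha>, \<beta>) *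
        cinner (A (op_monomial V \<beta> h)) (op_monomial U \<alpha> k)) =
      (\<Sum>a\<in>Poly_Mapping.keys p. \<Sum>m\<in>M. \<Sum>l\<in>L. Poly_Mapping.lookup p a *
        bimonomial_value l m a * cinner (A (Q m h)) (P l k))"
      by (simp add: case_prod_unfold sum_distrib_left mult.assoc)
    also have "\<dots> = (\<Sum>m\<in>M. \<Sum>a\<in>Poly_Mapping.keys p. \<Sum>l\<in>L. Poly_Mapping.lookup p a *
        bimonomial_value l m a * cinner (A (Q m h)) (P l k))"
      by (rule sum.swap)
    \<comment> \<open>Summing over the exponents innermost collects, for each pair of summands, the
      value of p at its pair of joint eigenvalues.\<close>
    also have "\<dots> = (\<Sum>m\<in>M. \<Sum>l\<in>L. pm_eval (bimonomial_value l m) p * cinner (A (Q m h)) (P l k))"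
      unfolding pm_eval_def sum_distrib_right by (intro sum.cong refl sum.swap)
    also have "\<dots> = 0"
      by (intro sum.neutral ballI
          Rad_J_ideal_weight[OF assms(1,2,4) X assms(5,7) Y p] P(2) Q(2))
    finally show ?thesis .
  qed
  then show "p \<in> J_ideal A U V"
    by (simp add: mem_J_ideal_iff[OF U(2,1)])
qed

end
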